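(* Let $\mathbb{P}_n$ be the set of $n\times n$ Hermitian positive definite complex matrices, and for $X,Y\in\mathbb{P}_n$ let $\delta_S(X,Y)\ge 0$ be defined by $$\delta_S^2(X,Y) := \log\det\left(\frac{X+Y}{2}\right)-\frac12\log\det(XY).$$ Then $\delta_S$ is a metric on $\mathbb{P}_n$.
   Context: $\delta_S(X,Y)$ denotes the nonnegative square root of the quantity $\delta_S^2(X,Y)$ (the S-divergence), which is nonnegative. *)

theory Defs
  imports "HOL-Analysis.Abstract_Metric_Spaces" "Jordan_Normal_Form.Schur_Decomposition"
begin

text \<open>For square \<open>X\<close>, \<open>mat_adjoint X\<close> is the conjugate transpose, and \<open>(X *\<^sub>v v) \<bullet>c v\<close> is
  \<open>v\<^sup>* X v\<close>; this number is real for Hermitian \<open>X\<close>, so \<open>Re\<close> is only a coercion.\<close>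

definition hermitian_posdef :: "nat \<Rightarrow> complex mat set" where
  "hermitian_posdef n = {X \<in> carrier_mat n n. mat_adjoint X = X \<and>
     (\<forall>v \<in> carrier_vec n. v \<noteq> 0\<^sub>v n \<longrightarrow> 0 < Re ((X *\<^sub>v v) \<bullet>c v))}"

text \<open>On positive definite arguments all determinants below are positive reals (although \<open>X * Y\<close>
  need not be Hermitian, \<open>det (X * Y) = det X * det Y\<close>), so again \<open>Re\<close> is only a coercion and
  \<open>ln\<close> is the real logarithm.\<close>

definition S_divergence :: "complex mat \<Rightarrow> complex mat \<Rightarrow> real" where
  "S_divergence X Y = ln (Re (det ((1/2) \<cdot>\<^sub>m (X + Y)))) - 1/2 * ln (Re (det (X * Y)))"

text \<open>The locale \<open>Metric_space\<close> requires nonnegativity and symmetry of the distance on the whole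
  type, not just on the carrier, so \<open>\<delta>\<^sub>S\<close> gets the value \<open>0\<close> outside its domain. On the
  domain, \<open>sqrt\<close> of a negative real would be negative in HOL, so nonnegativity of \<open>\<delta>\<^sub>S\<close> includes
  that of the S-divergence.\<close>

definition delta_S :: "nat \<Rightarrow> complex mat \<Rightarrow> complex mat \<Rightarrow> real" where
  "delta_S n X Y =
     (if X \<in> hermitian_posdef n \<and> Y \<in> hermitian_posdef n then sqrt (S_divergence X Y) else 0)"

end

theory Submission
  imports Defs "Jordan_Normal_Form.Spectral_Radius" "HOL-Analysis.L2_Norm"
begin

text \<open>For positive reals the S-divergence is \<open>ln (cosh ((ln x - ln y) / 2))\<close>, and the square root of
  \<open>ln \<circ> cosh\<close> is subadditive because \<open>ln (cosh u) / u\<^sup>2\<close> decreases on \<open>u > 0\<close>; Minkowski's inequality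
  extends the triangle inequality to positive diagonal matrices. The S-divergence is invariant under
  congruence, so for the triangle inequality through \<open>Z\<close> both end points may be taken to be
  diagonal. It then suffices to replace \<open>Z\<close> by a positive diagonal matrix \<open>G\<close> with
  \<open>det G = det Z\<close> and \<open>det (D + G) \<le> det (D + Z)\<close> for all positive diagonal \<open>D\<close>. Such a \<open>G\<close> arises
  by splitting off one coordinate at a time: replacing \<open>Z\<close> by its geometric mean with \<open>J Z J\<close>, where
  \<open>J = diag (-1, 1, \<dots>, 1)\<close>, kills the off-diagonal part of the first row and column. For
  \<open>Z = (a, U\<^sup>*; U, W)\<close> this mean is explicit: it has the blocks \<open>g = sqrt (a (a - U\<^sup>* W\<^sup>-\<^sup>1 U))\<close> and
  \<open>W - U U\<^sup>* / (a + g)\<close>, so no theory of matrix means is needed.\<close>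

unbundle no vec_syntax

section \<open>The scalar S-divergence\<close>

text \<open>Both sides vanish at 0, and the derivative of their difference has the sign of
  \<open>sinh w * cosh w - w\<close>. The bound controls the sign of the derivative of the ratio in
  \<open>ln_cosh_div_square_antimono\<close>.\<close>

lemma tanh_le_2_ln_cosh:
  fixes u :: real
  assumes "0 \<le> u"
  shows "u * tanh u \<le> 2 * ln (cosh u)"
proof -
  have k: "v \<le> sinh v * cosh v" if "0 \<le> v" for v :: real
  proof -
    have "(\<lambda>v. sinh v * cosh v - v) 0 \<le> (\<lambda>v. sinh v * cosh v - v) v"
    proof (rule DERIV_nonneg_imp_nondecreasing[OF that])
      fix w :: real
      have "((\<lambda>v. sinh v * cosh v - v) has_real_derivative (cosh w * cosh w + sinh w * sinh w - 1)) (at w)"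
        by (auto intro!: derivative_eq_intros)
      moreover have "cosh w * cosh w + sinh w * sinh w - 1 = 2 * (sinh w)\<^sup>2"
        using cosh_square_eq[of w] by (simp add: power2_eq_square)
      ultimately show "\<exists>y. ((\<lambda>v. sinh v * cosh v - v) has_real_derivative y) (at w) \<and> 0 \<le> y"
        by (metis zero_le_mult_iff zero_le_numeral zero_le_power2)
    qed
    thus ?thesis by simp
  qed
  have "(\<lambda>v. 2 * ln (cosh v) - v * tanh v) 0 \<le> (\<lambda>v. 2 * ln (cosh v) - v * tanh v) u"
  proof (rule DERIV_nonneg_imp_nondecreasing[OF assms])
    fix w :: real assume w: "0 \<le> w"
    have c: "cosh w > 0" by simp
    have "((\<lambda>v. 2 * ln (cosh v) - v * tanh v) has_real_derivative
        (2 * (sinh w / cosh w) - (tanh w + w * (1 - (tanh w)\<^sup>2)))) (at w)"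
      using c by (auto intro!: derivative_eq_intros)
    moreover have "1 - (tanh w)\<^sup>2 = ((cosh w)\<^sup>2 - (sinh w)\<^sup>2) / (cosh w)\<^sup>2"
      using c by (simp add: tanh_def power_divide diff_divide_distrib)
    hence "2 * (sinh w / cosh w) - (tanh w + w * (1 - (tanh w)\<^sup>2)) = (sinh w * cosh w - w) / (cosh w)\<^sup>2"
      using c unfolding hyperbolic_pythagoras by (simp add: tanh_def diff_divide_distrib power2_eq_square)
    ultimately show "\<exists>y. ((\<lambda>v. 2 * ln (cosh v) - v * tanh v) has_real_derivative y) (at w) \<and> 0 \<le> y"
      using k[OF w] by (metis diff_ge_0_iff_ge divide_nonneg_nonneg zero_le_power2)
  qed
  thus ?thesis by simp
qed

lemma ln_cosh_div_square_antimono: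
  fixes u w :: real
  assumes "0 < u" "u \<le> w"
  shows "ln (cosh w) / w\<^sup>2 \<le> ln (cosh u) / u\<^sup>2"
proof (rule DERIV_nonpos_imp_nonincreasing[OF assms(2)])
  fix v assume "u \<le> v"
  hence v: "v > 0" using assms by simp
  have "((\<lambda>x. ln (cosh x) / x\<^sup>2) has_real_derivative
      (sinh v / cosh v * v\<^sup>2 - ln (cosh v) * (2 * v)) / (v\<^sup>2 * v\<^sup>2)) (at v)"
    using v by (auto intro!: derivative_eq_intros)
  moreover have "sinh v / cosh v * v\<^sup>2 - ln (cosh v) * (2 * v) = v * (v * tanh v - 2 * ln (cosh v))"
    by (simp add: tanh_def power2_eq_square algebra_simps)
  moreover have "v * (v * tanh v - 2 * ln (cosh v)) \<le> 0"
    using tanh_le_2_ln_cosh[of v] v by (intro mult_nonneg_nonpos) auto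
  ultimately show "\<exists>y. ((\<lambda>x. ln (cosh x) / x\<^sup>2) has_real_derivative y) (at v) \<and> y \<le> 0"
    by (metis divide_nonpos_nonneg zero_le_mult_iff zero_le_power2)
qed

lemma ln_cosh_mono:
  fixes u w :: real
  assumes "\<bar>u\<bar> \<le> \<bar>w\<bar>"
  shows "ln (cosh u) \<le> ln (cosh w)"
proof -
  have "cosh \<bar>u\<bar> \<le> cosh \<bar>w\<bar>" using assms by (subst cosh_real_nonneg_le_iff) auto
  thus ?thesis by (simp add: cosh_real_abs)
qed

text \<open>If f(x) / x is antitone on x > 0 and s = u + v with u, v nonnegative, then f(s) = u f(s)
  / s + v f(s) / s is at most f(u) + f(v). Evenness and monotonicity in the absolute value reduce
  arbitrary signs to this case.\<close>

lemma sqrt_ln_cosh_subadditive: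
  fixes u v :: real
  shows "sqrt (ln (cosh (u + v))) \<le> sqrt (ln (cosh u)) + sqrt (ln (cosh v))"
proof -
  define f where "f x = sqrt (ln (cosh x))" for x :: real
  \<comment> \<open>Antitonicity of f(x) / x, multiplied by x so that x = 0 is covered: one of the
    two arguments may vanish.\<close>
  have ratio: "x * (f y / y) \<le> f x" if "0 \<le> x" "x \<le> y" "0 < y" for x y
  proof (cases "x = 0")
    case True thus ?thesis by (simp add: f_def)
  next
    case False
    hence x: "x > 0" using that by simp
    have "sqrt (ln (cosh y) / y\<^sup>2) \<le> sqrt (ln (cosh x) / x\<^sup>2)"
      using ln_cosh_div_square_antimono[OF x that(2)] by simp
    hence "f y / y \<le> f x / x" using that x by (simp add: f_def real_sqrt_divide)
    thus ?thesis using x by (simp add: field_simps)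
  qed
  have "f (u + v) \<le> f (\<bar>u\<bar> + \<bar>v\<bar>)"
    unfolding f_def by (intro real_sqrt_le_mono ln_cosh_mono) auto
  also have "\<dots> \<le> f \<bar>u\<bar> + f \<bar>v\<bar>"
  proof (cases "\<bar>u\<bar> + \<bar>v\<bar> = 0")
    case True
    hence "u = 0" "v = 0" by auto
    thus ?thesis by (simp add: f_def)
  next
    case False
    define s where "s = \<bar>u\<bar> + \<bar>v\<bar>"
    have s: "s > 0" using False by (simp add: s_def)
    have "f s = \<bar>u\<bar> * (f s / s) + \<bar>v\<bar> * (f s / s)"
      using s unfolding distrib_right[symmetric] s_def[symmetric] by simp
    also have "\<dots> \<le> f \<bar>u\<bar> + f \<bar>v\<bar>"
      using s by (intro add_mono ratio) (auto simp: s_def)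
    finally show ?thesis by (simp add: s_def)
  qed
  finally show ?thesis by (simp add: f_def cosh_real_abs)
qed

text \<open>The logarithm of the ratio of the arithmetic to the geometric mean: the S-divergence of
  1 by 1 matrices.\<close>

definition scalar_S :: "real \<Rightarrow> real \<Rightarrow> real" where
  "scalar_S x y = ln ((x + y) / 2) - (ln x + ln y) / 2"

lemma scalar_S_eq_ln_cosh:
  assumes "x > 0" "y > 0"
  shows "scalar_S x y = ln (cosh ((ln x - ln y) / 2))"
proof -
  \<comment> \<open>With x = exp (m + d) and y = exp (m - d), the geometric mean exp m factors out
    of the arithmetic mean and leaves cosh d.\<close>
  define m d where "m = (ln x + ln y) / 2" and "d = (ln x - ln y) / 2"
  have "ln x = m + d" "ln y = m - d" by (simp_all add: m_def d_def field_simps)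
  hence "x = exp (m + d)" "y = exp (m - d)" using assms by (metis exp_ln)+
  hence "(x + y) / 2 = exp m * cosh d" by (simp add: exp_add exp_diff cosh_def exp_minus field_simps)
  hence "ln ((x + y) / 2) = m + ln (cosh d)" by (simp add: ln_mult)
  thus ?thesis by (simp add: scalar_S_def m_def d_def)
qed

lemma scalar_S_nonneg: "x > 0 \<Longrightarrow> y > 0 \<Longrightarrow> 0 \<le> scalar_S x y"
  by (simp add: scalar_S_eq_ln_cosh cosh_real_ge_1)

lemma scalar_S_eq_0_iff:
  assumes "x > 0" "y > 0"
  shows "scalar_S x y = 0 \<longleftrightarrow> x = y"
  using assms by (simp add: scalar_S_eq_ln_cosh cosh_real_one_iff)

lemma sqrt_scalar_S_triangle:
  assumes "x > 0" "y > 0" "z > 0"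
  shows "sqrt (scalar_S x y) \<le> sqrt (scalar_S x z) + sqrt (scalar_S z y)"
  using sqrt_ln_cosh_subadditive[of "(ln x - ln z) / 2" "(ln z - ln y) / 2"] assms
  by (simp add: scalar_S_eq_ln_cosh field_simps)

text \<open>Each term is the \<open>L2_set\<close> norm of the coordinatewise distances, so the
  scalar triangle inequality combines with Minkowski's inequality.\<close>

lemma sqrt_sum_scalar_S_triangle:
  assumes "\<And>i. i \<in> A \<Longrightarrow> x i > 0" "\<And>i. i \<in> A \<Longrightarrow> y i > 0" "\<And>i. i \<in> A \<Longrightarrow> z i > 0"
  shows "sqrt (\<Sum>i\<in>A. scalar_S (x i) (y i)) \<le>
    sqrt (\<Sum>i\<in>A. scalar_S (x i) (z i)) + sqrt (\<Sum>i\<in>A. scalar_S (z i) (y i))"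
proof -
  have L2: "sqrt (\<Sum>i\<in>A. scalar_S (f i) (g i)) = L2_set (\<lambda>i. sqrt (scalar_S (f i) (g i))) A"
    if "\<And>i. i \<in> A \<Longrightarrow> f i > 0" "\<And>i. i \<in> A \<Longrightarrow> g i > 0" for f g
    unfolding L2_set_def using that by (auto intro!: sum.cong simp: scalar_S_nonneg)
  have "sqrt (\<Sum>i\<in>A. scalar_S (x i) (y i)) = L2_set (\<lambda>i. sqrt (scalar_S (x i) (y i))) A"
    using assms by (intro L2)
  also have "\<dots> \<le> L2_set (\<lambda>i. sqrt (scalar_S (x i) (z i)) + sqrt (scalar_S (z i) (y i))) A"
    using assms by (intro L2_set_mono sqrt_scalar_S_triangle) (auto simp: scalar_S_nonneg)
  also have "\<dots> \<le> L2_set (\<lambda>i. sqrt (scalar_S (x i) (z i))) A + L2_set (\<lambda>i. sqrt (scalar_S (z i) (y i))) A"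
    by (rule L2_set_triangle_ineq)
  also have "\<dots> = sqrt (\<Sum>i\<in>A. scalar_S (x i) (z i)) + sqrt (\<Sum>i\<in>A. scalar_S (z i) (y i))"
    using assms by (simp add: L2)
  finally show ?thesis .
qed

section \<open>Conjugate transpose and positive definiteness\<close>

lemma mat_adjoint_dim [simp]:
  "dim_row (mat_adjoint A) = dim_col A" "dim_col (mat_adjoint A) = dim_row A"
  unfolding mat_adjoint_def by simp_all

lemma mat_adjoint_carrier [simp]: "A \<in> carrier_mat m n \<Longrightarrow> mat_adjoint A \<in> carrier_mat n m"
  by (intro carrier_matI) simp_all

lemma mat_adjoint_index [simp]:
  "i < dim_col A \<Longrightarrow> j < dim_row A \<Longrightarrow> mat_adjoint A $$ (i, j) = conjugate (A $$ (j, i))"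
  unfolding mat_adjoint_def by (subst mat_of_rows_index) simp_all

lemma mat_adjoint_adjoint [simp]: "mat_adjoint (mat_adjoint A) = A"
  by (rule eq_matI) auto

lemma mat_adjoint_zero [simp]: "mat_adjoint (0\<^sub>m m n) = 0\<^sub>m n m"
  by (rule eq_matI) auto

lemma mat_adjoint_one [simp]: "mat_adjoint (1\<^sub>m n :: complex mat) = 1\<^sub>m n"
  by (rule eq_matI) auto

lemma mat_adjoint_add:
  "A \<in> carrier_mat m n \<Longrightarrow> B \<in> carrier_mat m n \<Longrightarrow> mat_adjoint (A + B) = mat_adjoint A + mat_adjoint B"
  by (rule eq_matI) (auto simp: conjugate_dist_add)

lemma mat_adjoint_smult: "mat_adjoint (c \<cdot>\<^sub>m A) = conjugate c \<cdot>\<^sub>m mat_adjoint A"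
  by (rule eq_matI) (auto simp: conjugate_dist_mul)

lemma mat_adjoint_mult:
  assumes "A \<in> carrier_mat l m" "B \<in> carrier_mat m n"
  shows "mat_adjoint (A * B) = mat_adjoint B * mat_adjoint A"
  by (rule eq_matI)
     (use assms in \<open>auto simp: scalar_prod_def sum_conjugate conjugate_dist_mul mult.commute intro!: sum.cong\<close>)

lemma mat_adjoint_four_block:
  assumes "A \<in> carrier_mat k m" "B \<in> carrier_mat k n" "C \<in> carrier_mat l m" "D \<in> carrier_mat l n"
  shows "mat_adjoint (four_block_mat A B C D) =
    four_block_mat (mat_adjoint A) (mat_adjoint C) (mat_adjoint B) (mat_adjoint D)"
  by (rule eq_matI) (use assms in auto)

lemma mult_mat_vec_0: "A \<in> carrier_mat m n \<Longrightarrow> A *\<^sub>v 0\<^sub>v n = (0\<^sub>v m :: 'a :: comm_ring_1 vec)"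
  by (rule eq_vecI) auto

lemma det_mat_adjoint:
  fixes A :: "complex mat"
  assumes "A \<in> carrier_mat n n"
  shows "det (mat_adjoint A) = cnj (det A)"
proof -
  interpret comm_ring_hom cnj by standard auto
  have "mat_adjoint A = map_mat cnj (transpose_mat A)"
    by (rule eq_matI) auto
  thus ?thesis using hom_det[of "transpose_mat A"] det_transpose[OF assms] by simp
qed

lemma scalar_prod_mat_adjoint:
  assumes "A \<in> carrier_mat m n" "v \<in> carrier_vec n" "w \<in> carrier_vec m"
  shows "(A *\<^sub>v v) \<bullet>c w = v \<bullet>c (mat_adjoint A *\<^sub>v w)"
proof -
  have "(A *\<^sub>v v) \<bullet>c w = (\<Sum>i<m. \<Sum>j<n. A $$ (i, j) * v $ j * conjugate (w $ i))"
    using assms by (auto simp: scalar_prod_def atLeast0LessThan sum_distrib_right intro!: sum.cong)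
  also have "\<dots> = (\<Sum>j<n. \<Sum>i<m. A $$ (i, j) * v $ j * conjugate (w $ i))"
    by (rule sum.swap)
  also have "\<dots> = v \<bullet>c (mat_adjoint A *\<^sub>v w)"
    using assms by (auto simp: scalar_prod_def atLeast0LessThan sum_distrib_left
        sum_conjugate conjugate_dist_mul mult.commute mult.left_commute intro!: sum.cong)
  finally show ?thesis .
qed

section \<open>Positive definite matrices under sums, scaling and congruence\<close>

lemma hermitian_posdefD:
  assumes "X \<in> hermitian_posdef n"
  shows "X \<in> carrier_mat n n" "mat_adjoint X = X"
    "\<And>v. v \<in> carrier_vec n \<Longrightarrow> v \<noteq> 0\<^sub>v n \<Longrightarrow> 0 < Re ((X *\<^sub>v v) \<bullet>c v)"
  using assms unfolding hermitian_posdef_def by auto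

lemma hermitian_posdef_add:
  assumes X: "X \<in> hermitian_posdef n" and Y: "Y \<in> hermitian_posdef n"
  shows "X + Y \<in> hermitian_posdef n"
  unfolding hermitian_posdef_def
proof (intro CollectI conjI ballI impI)
  note x = hermitian_posdefD[OF X] and y = hermitian_posdefD[OF Y]
  show "X + Y \<in> carrier_mat n n" using x y by auto
  show "mat_adjoint (X + Y) = X + Y" using x y by (simp add: mat_adjoint_add[of _ n n])
  fix v :: "complex vec" assume v: "v \<in> carrier_vec n" "v \<noteq> 0\<^sub>v n"
  have "((X + Y) *\<^sub>v v) \<bullet>c v = (X *\<^sub>v v) \<bullet>c v + (Y *\<^sub>v v) \<bullet>c v"
    using x(1) y(1) v by (simp add: add_mult_distrib_mat_vec[of _ n n] add_scalar_prod_distrib[of _ n])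
  thus "0 < Re (((X + Y) *\<^sub>v v) \<bullet>c v)" using x(3)[OF v] y(3)[OF v] by simp
qed

lemma hermitian_posdef_smult:
  assumes X: "X \<in> hermitian_posdef n" and c: "c > 0"
  shows "complex_of_real c \<cdot>\<^sub>m X \<in> hermitian_posdef n"
  unfolding hermitian_posdef_def
proof (intro CollectI conjI ballI impI)
  note x = hermitian_posdefD[OF X]
  show "complex_of_real c \<cdot>\<^sub>m X \<in> carrier_mat n n" using x by auto
  show "mat_adjoint (complex_of_real c \<cdot>\<^sub>m X) = complex_of_real c \<cdot>\<^sub>m X"
    using x by (simp add: mat_adjoint_smult)
  fix v :: "complex vec" assume v: "v \<in> carrier_vec n" "v \<noteq> 0\<^sub>v n"
  have "complex_of_real c \<cdot>\<^sub>m X *\<^sub>v v = complex_of_real c \<cdot>\<^sub>v (X *\<^sub>v v)"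
    using x(1) v by (intro eq_vecI) (auto simp: scalar_prod_def sum_distrib_left mult.assoc)
  hence "(complex_of_real c \<cdot>\<^sub>m X *\<^sub>v v) \<bullet>c v = complex_of_real c * ((X *\<^sub>v v) \<bullet>c v)"
    using x(1) v by simp
  thus "0 < Re ((complex_of_real c \<cdot>\<^sub>m X *\<^sub>v v) \<bullet>c v)" using x(3)[OF v] c by simp
qed

text \<open>Writing ^H for the conjugate transpose, the quadratic form of T^H X T at v is that of X
  at \<open>T *\<^sub>v v\<close>, which is nonzero because T is injective.\<close>

lemma hermitian_posdef_congruence:
  assumes X: "X \<in> hermitian_posdef n" and T: "T \<in> carrier_mat n n" "det T \<noteq> 0"
  shows "mat_adjoint T * X * T \<in> hermitian_posdef n"
  unfolding hermitian_posdef_def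
proof (intro CollectI conjI ballI impI)
  note x = hermitian_posdefD[OF X]
  have T': "mat_adjoint T \<in> carrier_mat n n" using T by simp
  show "mat_adjoint T * X * T \<in> carrier_mat n n" using x T T' by auto
  show "mat_adjoint (mat_adjoint T * X * T) = mat_adjoint T * X * T"
    using x T T' by (simp add: mat_adjoint_mult[of _ n n _ n] assoc_mult_mat[of _ n n _ n _ n])
  fix v :: "complex vec" assume v: "v \<in> carrier_vec n" "v \<noteq> 0\<^sub>v n"
  have Tv: "T *\<^sub>v v \<in> carrier_vec n" by (rule mult_mat_vec_carrier[OF T(1) v(1)])
  have Tv0: "T *\<^sub>v v \<noteq> 0\<^sub>v n" using T v det_0_iff_vec_prod_zero[OF T(1)] by blast
  have eq: "(mat_adjoint T * X * T) *\<^sub>v v = mat_adjoint T *\<^sub>v (X *\<^sub>v (T *\<^sub>v v))"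
    using assoc_mult_mat_vec[OF mult_carrier_mat[OF T' x(1)] T(1) v(1)] assoc_mult_mat_vec[OF T' x(1) Tv]
    by (rule trans)
  show "0 < Re (((mat_adjoint T * X * T) *\<^sub>v v) \<bullet>c v)"
    unfolding eq using x(3)[OF Tv Tv0] x(1) T T' v Tv scalar_prod_mat_adjoint[of "mat_adjoint T" n n "X *\<^sub>v (T *\<^sub>v v)" v] by simp
qed

lemma hermitian_posdef_det_nonzero:
  assumes X: "X \<in> hermitian_posdef n"
  shows "det X \<noteq> 0"
proof
  note x = hermitian_posdefD[OF X]
  assume "det X = 0"
  then obtain v where v: "v \<in> carrier_vec n" "v \<noteq> 0\<^sub>v n" "X *\<^sub>v v = 0\<^sub>v n"
    using det_0_iff_vec_prod_zero[OF x(1)] by blast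
  thus False using x(3)[OF v(1,2)] by simp
qed

section \<open>Diagonal blocks and Schur complements\<close>

lemma hermitian_posdef_four_blockD:
  assumes Z: "four_block_mat A (mat_adjoint U) U W \<in> hermitian_posdef (m + n)"
    and [simp]: "A \<in> carrier_mat m m" "U \<in> carrier_mat n m" "W \<in> carrier_mat n n"
  shows "A \<in> hermitian_posdef m" "W \<in> hermitian_posdef n"
proof -
  let ?Z = "four_block_mat A (mat_adjoint U) U W"
  note z = hermitian_posdefD[OF Z]
  have dims [simp]: "dim_row A = m" "dim_col A = m" "dim_row W = n" "dim_col W = n"
    "dim_row U = n" "dim_col U = m"
    using carrier_matD[OF assms(2)] carrier_matD[OF assms(3)] carrier_matD[OF assms(4)] by auto
  have adj: "mat_adjoint ?Z = four_block_mat (mat_adjoint A) (mat_adjoint U) U (mat_adjoint W)"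
    by (subst mat_adjoint_four_block[of _ m m _ n _ n]) auto
  have "mat_adjoint A = A"
  proof (rule eq_matI)
    fix i j assume ij: "i < dim_row A" "j < dim_col A"
    hence "mat_adjoint ?Z $$ (i, j) = ?Z $$ (i, j)" using z(2) by simp
    thus "mat_adjoint A $$ (i, j) = A $$ (i, j)" unfolding adj using ij by simp
  qed auto
  moreover have "0 < Re ((A *\<^sub>v v) \<bullet>c v)" if v: "v \<in> carrier_vec m" "v \<noteq> 0\<^sub>v m" for v
  proof -
    \<comment> \<open>Padding v with zeros turns the quadratic form of the full matrix into that of
      A; the block W is treated in the same way below.\<close>
    have "v @\<^sub>v 0\<^sub>v n \<noteq> 0\<^sub>v (m + n)"
    proof
      assume *: "v @\<^sub>v 0\<^sub>v n = 0\<^sub>v (m + n)"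
      have "v $ i = 0" if "i < m" for i
        using arg_cong[OF *, of "\<lambda>w. w $ i"] that v by simp
      thus False using v by (auto intro: eq_vecI)
    qed
    hence "0 < Re ((?Z *\<^sub>v (v @\<^sub>v 0\<^sub>v n)) \<bullet>c (v @\<^sub>v 0\<^sub>v n))" using v by (intro z(3)) auto
    moreover have "?Z *\<^sub>v (v @\<^sub>v 0\<^sub>v n) = (A *\<^sub>v v) @\<^sub>v (U *\<^sub>v v)"
      using v mult_mat_vec_carrier[OF assms(2), of v] mult_mat_vec_carrier[OF assms(3), of v]
        mult_mat_vec_carrier[OF assms(4), of v] mult_mat_vec_carrier[of "mat_adjoint U" m n v]
      by (subst four_block_mat_mult_vec[of _ m m _ n _ n])
         (auto simp: mult_mat_vec_0[of _ m m] mult_mat_vec_0[of _ n m] mult_mat_vec_0[of _ m n] mult_mat_vec_0[of _ n n])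
    moreover have "conjugate (v @\<^sub>v 0\<^sub>v n) = conjugate v @\<^sub>v 0\<^sub>v n" using v by (intro eq_vecI) auto
    ultimately show ?thesis
      using v mult_mat_vec_carrier[OF assms(2) v(1)] mult_mat_vec_carrier[OF assms(3) v(1)]
      by (simp add: scalar_prod_append[of _ m _ n])
  qed
  ultimately show "A \<in> hermitian_posdef m" by (simp add: hermitian_posdef_def)
  have "mat_adjoint W = W"
  proof (rule eq_matI)
    fix i j assume ij: "i < dim_row W" "j < dim_col W"
    hence "mat_adjoint ?Z $$ (m + i, m + j) = ?Z $$ (m + i, m + j)" using z(2) by simp
    thus "mat_adjoint W $$ (i, j) = W $$ (i, j)" unfolding adj using ij by simp
  qed auto
  moreover have "0 < Re ((W *\<^sub>v v) \<bullet>c v)" if v: "v \<in> carrier_vec n" "v \<noteq> 0\<^sub>v n" for v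
  proof -
    have "0\<^sub>v m @\<^sub>v v \<noteq> 0\<^sub>v (m + n)"
    proof
      assume *: "0\<^sub>v m @\<^sub>v v = 0\<^sub>v (m + n)"
      have "v $ i = 0" if "i < n" for i
        using arg_cong[OF *, of "\<lambda>w. w $ (m + i)"] that v by simp
      thus False using v by (auto intro: eq_vecI)
    qed
    hence "0 < Re ((?Z *\<^sub>v (0\<^sub>v m @\<^sub>v v)) \<bullet>c (0\<^sub>v m @\<^sub>v v))" using v by (intro z(3)) auto
    moreover have "?Z *\<^sub>v (0\<^sub>v m @\<^sub>v v) = (mat_adjoint U *\<^sub>v v) @\<^sub>v (W *\<^sub>v v)"
      using v mult_mat_vec_carrier[OF assms(2), of v] mult_mat_vec_carrier[OF assms(3), of v]
        mult_mat_vec_carrier[OF assms(4), of v] mult_mat_vec_carrier[of "mat_adjoint U" m n v]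
      by (subst four_block_mat_mult_vec[of _ m m _ n _ n])
         (auto simp: mult_mat_vec_0[of _ m m] mult_mat_vec_0[of _ n m] mult_mat_vec_0[of _ m n] mult_mat_vec_0[of _ n n])
    moreover have "conjugate (0\<^sub>v m @\<^sub>v v) = 0\<^sub>v m @\<^sub>v conjugate v" using v by (intro eq_vecI) auto
    ultimately show ?thesis
      using v mult_mat_vec_carrier[of "mat_adjoint U" m n v] mult_mat_vec_carrier[OF assms(4) v(1)]
      by (simp add: scalar_prod_append[of _ m _ n])
  qed
  ultimately show "W \<in> hermitian_posdef n" by (simp add: hermitian_posdef_def)
qed

lemma hermitian_posdef_1E:
  assumes A: "A \<in> hermitian_posdef 1"
  obtains a where "a > 0" "A = complex_of_real a \<cdot>\<^sub>m 1\<^sub>m 1"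
proof -
  note h = hermitian_posdefD[OF A]
  let ?e = "unit_vec 1 0 :: complex vec"
  have "?e \<noteq> 0\<^sub>v 1" using unit_vec_nonzero[of 0 1] by simp
  hence "0 < Re ((A *\<^sub>v ?e) \<bullet>c ?e)" by (intro h(3)) auto
  also have "(A *\<^sub>v ?e) \<bullet>c ?e = A $$ (0, 0)" using h(1) by (auto simp: scalar_prod_def)
  finally have "Re (A $$ (0, 0)) > 0" .
  moreover have "mat_adjoint A $$ (0, 0) = cnj (A $$ (0, 0))" using h(1) by auto
  hence "A $$ (0, 0) = complex_of_real (Re (A $$ (0, 0)))" unfolding h(2) by (simp add: complex_eq_iff)
  hence "A = complex_of_real (Re (A $$ (0, 0))) \<cdot>\<^sub>m 1\<^sub>m 1" using h(1) by (intro eq_matI) auto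
  ultimately show thesis using that by blast
qed

text \<open>One step of block elimination: the unit triangular E clears the row and column next to
  the pivot a. Positive definiteness survives the congruence and passes to the diagonal block
  S.\<close>

lemma hermitian_posdef_schur_complement:
  assumes Z: "four_block_mat (complex_of_real a \<cdot>\<^sub>m 1\<^sub>m 1) (mat_adjoint U) U W \<in> hermitian_posdef (Suc n)"
    and U: "U \<in> carrier_mat n 1" and W: "W \<in> carrier_mat n n" and a: "a \<noteq> 0"
  defines "E \<equiv> four_block_mat (1\<^sub>m 1) (complex_of_real (- 1 / a) \<cdot>\<^sub>m mat_adjoint U) (0\<^sub>m n 1) (1\<^sub>m n)"
  defines "S \<equiv> W - complex_of_real (1 / a) \<cdot>\<^sub>m (U * mat_adjoint U)"
  shows "E \<in> carrier_mat (Suc n) (Suc n)" "det E = 1"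
    "mat_adjoint E * four_block_mat (complex_of_real a \<cdot>\<^sub>m 1\<^sub>m 1) (mat_adjoint U) U W * E =
      four_block_mat (complex_of_real a \<cdot>\<^sub>m 1\<^sub>m 1) (0\<^sub>m 1 n) (0\<^sub>m n 1) S"
    "S \<in> hermitian_posdef n"
proof -
  let ?a = "complex_of_real a" and ?U = "mat_adjoint U"
  let ?Z = "four_block_mat (?a \<cdot>\<^sub>m 1\<^sub>m 1) ?U U W"
  let ?b = "complex_of_real (- 1 / a)"
  have U': "?U \<in> carrier_mat 1 n" using U by simp
  have [simp]: "dim_row U = n" "dim_col U = 1" "dim_row W = n" "dim_col W = n" using U W by auto
  have S: "S \<in> carrier_mat n n" unfolding S_def by (auto intro!: carrier_matI)
  have "E \<in> carrier_mat (1 + n) (1 + n)"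
    unfolding E_def by (rule four_block_carrier_mat) auto
  thus E: "E \<in> carrier_mat (Suc n) (Suc n)" by simp
  show dE: "det E = 1"
    unfolding E_def using U' by (subst det_four_block_mat_lower_left_zero[of _ 1 _ n]) auto
  have ZE: "?Z * E = four_block_mat (?a \<cdot>\<^sub>m 1\<^sub>m 1) (0\<^sub>m 1 n) U S"
    unfolding E_def
    by (subst mult_four_block_mat[of _ 1 1 _ n _ n _ _ 1 _ n])
       (use U U' W a in \<open>auto intro!: cong_four_block_mat eq_matI simp: S_def scalar_prod_def\<close>)
  have EA: "mat_adjoint E = four_block_mat (1\<^sub>m 1) (0\<^sub>m 1 n) (?b \<cdot>\<^sub>m U) (1\<^sub>m n)"
    unfolding E_def
    by (subst mat_adjoint_four_block[of _ 1 1 _ n _ n]) (use U U' in \<open>auto simp: mat_adjoint_smult\<close>)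
  have "mat_adjoint E * (?Z * E) = four_block_mat (?a \<cdot>\<^sub>m 1\<^sub>m 1) (0\<^sub>m 1 n) (0\<^sub>m n 1) S"
    unfolding ZE EA
    by (subst mult_four_block_mat[of _ 1 1 _ n _ n _ _ 1 _ n])
       (use U U' S a in \<open>auto intro!: cong_four_block_mat eq_matI simp: scalar_prod_def\<close>)
  moreover have "mat_adjoint E * ?Z * E = mat_adjoint E * (?Z * E)"
    by (rule assoc_mult_mat[OF mat_adjoint_carrier[OF E] hermitian_posdefD(1)[OF Z] E])
  ultimately show eq: "mat_adjoint E * ?Z * E = four_block_mat (?a \<cdot>\<^sub>m 1\<^sub>m 1) (0\<^sub>m 1 n) (0\<^sub>m n 1) S"
    by simp
  have "mat_adjoint E * ?Z * E \<in> hermitian_posdef (Suc n)"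
    using dE by (intro hermitian_posdef_congruence Z E) simp
  \<comment> \<open>The upper right zero block is written as an adjoint to match the shape required
    by \<open>hermitian_posdef_four_blockD\<close>.\<close>
  hence "four_block_mat (?a \<cdot>\<^sub>m 1\<^sub>m 1) (mat_adjoint (0\<^sub>m n 1)) (0\<^sub>m n 1) S \<in> hermitian_posdef (1 + n)"
    unfolding eq by simp
  thus "S \<in> hermitian_posdef n" by (rule hermitian_posdef_four_blockD(2)) (use S in auto)
qed

text \<open>Splits off the first coordinate for the inductions on the size. The last clause ties U
  to the first column of Z; simultaneous diagonalization uses it to show that this block
  vanishes.\<close>

lemma hermitian_posdef_SucE:
  assumes Z: "Z \<in> hermitian_posdef (Suc n)"
  obtains a U W where "a > 0" "U \<in> carrier_mat n 1" "W \<in> hermitian_posdef n"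
    "Z = four_block_mat (complex_of_real a \<cdot>\<^sub>m 1\<^sub>m 1) (mat_adjoint U) U W"
    "\<And>i. i < n \<Longrightarrow> U $$ (i, 0) = Z $$ (Suc i, 0)"
proof -
  note z = hermitian_posdefD[OF Z]
  obtain A B U W where sp: "split_block Z 1 1 = (A, B, U, W)" by (cases "split_block Z 1 1")
  note blk = split_block[OF sp, of n n]
  have c: "A \<in> carrier_mat 1 1" "B \<in> carrier_mat 1 n" "U \<in> carrier_mat n 1" "W \<in> carrier_mat n n"
    and Zeq: "Z = four_block_mat A B U W" using blk z(1) by auto
  have B: "B = mat_adjoint U"
  proof (rule eq_matI)
    fix i j assume ij: "i < dim_row (mat_adjoint U)" "j < dim_col (mat_adjoint U)"
    hence ij': "i = 0" "j < n" using c by auto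
    have "mat_adjoint Z $$ (0, Suc j) = cnj (Z $$ (Suc j, 0))" using z(1) ij' by simp
    hence "Z $$ (0, Suc j) = cnj (Z $$ (Suc j, 0))" unfolding z(2) .
    thus "B $$ (i, j) = mat_adjoint U $$ (i, j)" unfolding Zeq using ij' c by simp
  qed (use c in auto)
  have "four_block_mat A (mat_adjoint U) U W \<in> hermitian_posdef (1 + n)"
    using Z unfolding Zeq B by simp
  note h = hermitian_posdef_four_blockD[OF this c(1,3,4)]
  obtain a where "a > 0" "A = complex_of_real a \<cdot>\<^sub>m 1\<^sub>m 1" using hermitian_posdef_1E[OF h(1)] .
  moreover have "U $$ (i, 0) = Z $$ (Suc i, 0)" if "i < n" for i using that c unfolding Zeq by simp
  ultimately show thesis using c(3) h(2) Zeq unfolding B by (intro that[of a U W]) auto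
qed

text \<open>V stands for P^-1 U, so that the lower left block is given as P V and no inverse occurs.
  A column operation clears that block and leaves the scalar Schur complement A - B V.\<close>

lemma det_bordered:
  fixes P :: "'a :: idom mat"
  assumes P: "P \<in> carrier_mat n n" and V: "V \<in> carrier_mat n 1"
    and A: "A \<in> carrier_mat 1 1" and B: "B \<in> carrier_mat 1 n"
  shows "det (four_block_mat A B (P * V) P) = det P * (A $$ (0, 0) - (B * V) $$ (0, 0))"
proof -
  let ?M = "four_block_mat A B (P * V) P"
  let ?E = "four_block_mat (1\<^sub>m 1) (0\<^sub>m 1 n) (- V) (1\<^sub>m n)"
  have M: "?M \<in> carrier_mat (1 + n) (1 + n)" and E: "?E \<in> carrier_mat (1 + n) (1 + n)"
    using A P by (auto intro!: four_block_carrier_mat)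
  have PV: "P * - V = - (P * V)" using P V by (intro eq_matI) auto
  have BV: "B * - V = - (B * V)" using B V by (intro eq_matI) auto
  have "?M * ?E = four_block_mat (A - B * V) B (0\<^sub>m n 1) P"
    by (subst mult_four_block_mat[of _ 1 1 _ n _ n _ _ 1 _ n])
       (use assms PV BV in \<open>auto intro!: cong_four_block_mat eq_matI\<close>)
  hence "det ?M * det ?E = det (four_block_mat (A - B * V) B (0\<^sub>m n 1) P)"
    using det_mult[OF M E] by simp
  also have "\<dots> = det (A - B * V) * det P"
    using assms by (intro det_four_block_mat_lower_left_zero) auto
  also have "det (A - B * V) = A $$ (0, 0) - (B * V) $$ (0, 0)"
    using assms by (subst det_single) auto
  also have "det ?E = 1"
    using V by (subst det_four_block_mat_upper_right_zero[of _ 1 _ n]) auto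
  finally show ?thesis by (simp add: mult.commute)
qed

text \<open>The matrix determinant lemma. The determinant of the bordered matrix \<open>?M\<close>
  is evaluated twice: by column elimination with \<open>?E\<close> and by
  \<open>det_bordered\<close>.\<close>

lemma det_rank_one_update:
  fixes P :: "'a :: idom mat"
  assumes P: "P \<in> carrier_mat n n" and V: "V \<in> carrier_mat n 1" and B: "B \<in> carrier_mat 1 n"
  shows "det (P - t \<cdot>\<^sub>m (P * V * B)) = det P * (1 - t * (B * V) $$ (0, 0))"
proof -
  let ?M = "four_block_mat (1\<^sub>m 1) (t \<cdot>\<^sub>m B) (P * V) P"
  let ?E = "four_block_mat (1\<^sub>m 1) (- t \<cdot>\<^sub>m B) (0\<^sub>m n 1) (1\<^sub>m n)"
  have M: "?M \<in> carrier_mat (1 + n) (1 + n)" and E: "?E \<in> carrier_mat (1 + n) (1 + n)"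
    using P by (auto intro!: four_block_carrier_mat)
  have PV: "P * V \<in> carrier_mat n 1" using P V by simp
  have PVB: "P * V * B \<in> carrier_mat n n" using PV B by (rule mult_carrier_mat)
  \<comment> \<open>Facts 1 to 4 are the blocks of \<open>?M * ?E\<close>: upper right, lower right,
    upper left, lower left.\<close>
  have 1: "1\<^sub>m 1 * (- t \<cdot>\<^sub>m B) + t \<cdot>\<^sub>m B * 1\<^sub>m n = 0\<^sub>m 1 n"
    unfolding left_mult_one_mat[OF smult_carrier_mat[OF B]] right_mult_one_mat[OF smult_carrier_mat[OF B]]
    using carrier_matD[OF B] by (intro eq_matI) simp_all
  have 2: "P * V * (- t \<cdot>\<^sub>m B) + P * 1\<^sub>m n = P - t \<cdot>\<^sub>m (P * V * B)"
    unfolding mult_smult_distrib[OF PV B] right_mult_one_mat[OF P]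
    using carrier_matD[OF P] carrier_matD[OF PVB] by (intro eq_matI) (simp_all del: index_mult_mat)
  have 3: "1\<^sub>m 1 * 1\<^sub>m 1 + t \<cdot>\<^sub>m B * 0\<^sub>m n 1 = (1\<^sub>m 1 :: 'a mat)"
    unfolding right_mult_zero_mat[OF smult_carrier_mat[OF B]] by (intro eq_matI) simp_all
  have 4: "P * V * 1\<^sub>m 1 + P * 0\<^sub>m n 1 = P * V"
    unfolding right_mult_one_mat[OF PV] right_mult_zero_mat[OF P] using PV by (rule right_add_zero_mat)
  have "?M * ?E = four_block_mat (1\<^sub>m 1) (0\<^sub>m 1 n) (P * V) (P - t \<cdot>\<^sub>m (P * V * B))"
    using mult_four_block_mat[OF one_carrier_mat smult_carrier_mat[OF B, of t] PV P
        one_carrier_mat smult_carrier_mat[OF B, of "- t"] zero_carrier_mat one_carrier_mat]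
    unfolding 1 2 3 4 .
  hence "det ?M * det ?E = det (four_block_mat (1\<^sub>m 1) (0\<^sub>m 1 n) (P * V) (P - t \<cdot>\<^sub>m (P * V * B)))"
    using det_mult[OF M E] by simp
  also have "\<dots> = det (P - t \<cdot>\<^sub>m (P * V * B))"
    using det_four_block_mat_upper_right_zero[OF one_carrier_mat refl PV minus_carrier_mat[OF smult_carrier_mat[OF PVB]]]
    by (simp only: det_one mult_1_left)
  also have "det ?E = 1"
    using B by (subst det_four_block_mat_lower_left_zero[of _ 1 _ n]) auto
  also have "det ?M = det P * (1 - (t \<cdot>\<^sub>m B * V) $$ (0, 0))"
    using assms by (subst det_bordered) auto
  also have "(t \<cdot>\<^sub>m B * V) $$ (0, 0) = t * (B * V) $$ (0, 0)"
    using B V by simp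
  finally show ?thesis by simp
qed

text \<open>The adjugate divided by the determinant is a right inverse. Solutions of such equations
  take the place of inverse matrices below.\<close>

lemma exists_solution:
  fixes P :: "'a :: field mat"
  assumes P: "P \<in> carrier_mat n n" "det P \<noteq> 0" and U: "U \<in> carrier_mat n m"
  obtains V where "V \<in> carrier_mat n m" "P * V = U"
proof -
  note adj = adj_mat[OF P(1)]
  let ?Q = "(1 / det P) \<cdot>\<^sub>m adj_mat P"
  have Q: "?Q \<in> carrier_mat n n" using adj by simp
  have PQ: "P * ?Q = 1\<^sub>m n"
    using mult_smult_distrib[OF P(1) adj(1)] adj(2) P(2) by (auto intro!: eq_matI)
  have "P * (?Q * U) = P * ?Q * U" by (rule assoc_mult_mat[OF P(1) Q U, symmetric])
  hence "P * (?Q * U) = U" unfolding PQ using U by simp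
  thus thesis using Q U that by (meson mult_carrier_mat)
qed

text \<open>Carries the quadratic form from vectors over to one-column matrices, the shape in which
  U occurs in the block decompositions. V may be zero, hence the weak inequality.\<close>

lemma hermitian_posdef_form:
  assumes M: "M \<in> hermitian_posdef n" and V: "V \<in> carrier_mat n 1"
  shows "0 \<le> Re ((mat_adjoint V * (M * V)) $$ (0, 0))"
    "Im ((mat_adjoint V * (M * V)) $$ (0, 0)) = 0"
proof -
  note m = hermitian_posdefD[OF M]
  let ?v = "col V 0"
  have v: "?v \<in> carrier_vec n" using V by auto
  have Mv: "M *\<^sub>v ?v \<in> carrier_vec n" using mult_mat_vec_carrier[OF m(1) v] .
  have eq: "(mat_adjoint V * (M * V)) $$ (0, 0) = (M *\<^sub>v ?v) \<bullet>c ?v"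
    using V m(1) by (auto simp: scalar_prod_def mult.commute intro!: sum.cong)
  show "0 \<le> Re ((mat_adjoint V * (M * V)) $$ (0, 0))"
  proof (cases "?v = 0\<^sub>v n")
    case True
    thus ?thesis unfolding eq True using mult_mat_vec_0[OF m(1)] by simp
  next
    case False
    thus ?thesis unfolding eq using m(3)[OF v] by simp
  qed
  have "(M *\<^sub>v ?v) \<bullet>c ?v = ?v \<bullet>c (M *\<^sub>v ?v)"
    using scalar_prod_mat_adjoint[OF m(1) v v] m(2) by simp
  also have "\<dots> = cnj ((M *\<^sub>v ?v) \<bullet>c ?v)"
    using conjugate_vec_sprod_comm[OF v Mv] conjugate_conjugate_sprod[OF v Mv]
      comm_scalar_prod[OF carrier_vec_conjugate[OF v] Mv] by simp
  finally show "Im ((mat_adjoint V * (M * V)) $$ (0, 0)) = 0" unfolding eq by (simp add: complex_eq_iff)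
qed

section \<open>Comparison with a diagonal matrix\<close>

text \<open>The entries come from a function on the naturals, so that dropping the first one is
  \<open>d \<circ> Suc\<close> and prepending one is \<open>case_nat\<close>.\<close>

definition real_diag_mat :: "nat \<Rightarrow> (nat \<Rightarrow> real) \<Rightarrow> complex mat" where
  "real_diag_mat n d = mat n n (\<lambda>(i, j). if i = j then complex_of_real (d i) else 0)"

lemma real_diag_mat_carrier [simp]: "real_diag_mat n d \<in> carrier_mat n n"
  by (simp add: real_diag_mat_def)

lemma real_diag_mat_dim [simp]: "dim_row (real_diag_mat n d) = n" "dim_col (real_diag_mat n d) = n"
  by (simp_all add: real_diag_mat_def)

lemma real_diag_mat_add: "real_diag_mat n d + real_diag_mat n e = real_diag_mat n (\<lambda>i. d i + e i)"
  by (rule eq_matI) (auto simp: real_diag_mat_def)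

lemma real_diag_mat_cong: "(\<And>i. i < n \<Longrightarrow> d i = e i) \<Longrightarrow> real_diag_mat n d = real_diag_mat n e"
  by (rule eq_matI) (auto simp: real_diag_mat_def)

lemma real_diag_mat_Suc:
  "real_diag_mat (Suc n) d =
    four_block_mat (complex_of_real (d 0) \<cdot>\<^sub>m 1\<^sub>m 1) (0\<^sub>m 1 n) (0\<^sub>m n 1) (real_diag_mat n (d \<circ> Suc))"
  by (rule eq_matI) (auto simp: real_diag_mat_def)

lemma det_real_diag_mat: "det (real_diag_mat n d) = complex_of_real (\<Prod>i<n. d i)"
proof (induction n arbitrary: d)
  case 0
  show ?case using det_dim_zero[OF real_diag_mat_carrier] by simp
next
  case (Suc n)
  have "det (real_diag_mat (Suc n) d) =
      det (complex_of_real (d 0) \<cdot>\<^sub>m 1\<^sub>m 1) * det (real_diag_mat n (d \<circ> Suc))"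
    unfolding real_diag_mat_Suc by (rule det_four_block_mat_lower_left_zero) auto
  thus ?case by (simp add: Suc.IH prod.lessThan_Suc_shift del: prod.lessThan_Suc)
qed

lemma real_diag_mat_posdef:
  assumes d: "\<And>i. i < n \<Longrightarrow> d i > 0"
  shows "real_diag_mat n d \<in> hermitian_posdef n"
  unfolding hermitian_posdef_def
proof (intro CollectI conjI ballI impI)
  show "real_diag_mat n d \<in> carrier_mat n n" by simp
  show "mat_adjoint (real_diag_mat n d) = real_diag_mat n d"
    by (rule eq_matI) (auto simp: real_diag_mat_def)
  fix v :: "complex vec" assume v: "v \<in> carrier_vec n" "v \<noteq> 0\<^sub>v n"
  have "(real_diag_mat n d *\<^sub>v v) $ i = complex_of_real (d i) * v $ i" if "i < n" for i
  proof -
    have "(real_diag_mat n d *\<^sub>v v) $ i = (\<Sum>j<n. (if i = j then complex_of_real (d i) else 0) * v $ j)"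
      using v that by (simp add: real_diag_mat_def scalar_prod_def atLeast0LessThan)
    also have "\<dots> = (\<Sum>j<n. if i = j then complex_of_real (d i) * v $ i else 0)"
      by (intro sum.cong) auto
    finally show ?thesis using that by simp
  qed
  hence "(real_diag_mat n d *\<^sub>v v) \<bullet>c v = (\<Sum>i<n. complex_of_real (d i) * v $ i * cnj (v $ i))"
    using v by (auto simp: scalar_prod_def atLeast0LessThan intro!: sum.cong)
  also have "\<dots> = (\<Sum>i<n. complex_of_real (d i * (cmod (v $ i))\<^sup>2))"
    by (intro sum.cong refl) (simp add: mult.assoc flip: complex_norm_square)
  finally have eq: "Re ((real_diag_mat n d *\<^sub>v v) \<bullet>c v) = (\<Sum>i<n. d i * (cmod (v $ i))\<^sup>2)" by simp
  obtain k where k: "k < n" "v $ k \<noteq> 0"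
  proof (rule ccontr)
    assume "\<not> thesis"
    hence "v = 0\<^sub>v n" using v(1) that by (intro eq_vecI) auto
    thus False using v(2) by simp
  qed
  show "0 < Re ((real_diag_mat n d *\<^sub>v v) \<bullet>c v)"
    unfolding eq by (rule sum_pos2[of _ k]) (use k d in \<open>auto simp: less_imp_le\<close>)
qed

text \<open>Antitonicity of \<open>P \<mapsto> U\<^sup>* P\<^sup>-\<^sup>1 U\<close>: here \<open>V = (D + W)\<^sup>-\<^sup>1 U\<close> and \<open>V0 = W\<^sup>-\<^sup>1 U\<close>.\<close>

lemma hermitian_posdef_inverse_form_antimono:
  assumes W: "W \<in> hermitian_posdef n" and D: "D \<in> hermitian_posdef n"
    and V: "V \<in> carrier_mat n 1" and V0: "V0 \<in> carrier_mat n 1"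
    and U: "(D + W) * V = U" "W * V0 = U"
  shows "Re ((mat_adjoint U * V) $$ (0, 0)) \<le> Re ((mat_adjoint U * V0) $$ (0, 0))"
proof -
  note w = hermitian_posdefD[OF W] and d = hermitian_posdefD[OF D]
  have Uc: "U \<in> carrier_mat n 1" using U(2) w(1) V0 by auto
  note c = w(1) d(1) V V0 Uc mat_adjoint_carrier[OF V] mat_adjoint_carrier[OF V0] mat_adjoint_carrier[OF Uc]
  have WV: "W * V \<in> carrier_mat n 1" and DV: "D * V \<in> carrier_mat n 1" using c by auto
  have dist: "U = D * V + W * V"
    using add_mult_distrib_mat[OF d(1) w(1) V] U(1) by simp
  define f where "f A B = (mat_adjoint A * B) $$ (0, 0)" for A B :: "complex mat"
  have f_add: "f A (B + C) = f A B + f A C"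
    if "A \<in> carrier_mat n 1" "B \<in> carrier_mat n 1" "C \<in> carrier_mat n 1" for A B C
    using mult_add_distrib_mat[OF mat_adjoint_carrier[OF that(1)] that(2,3)] that by (simp add: f_def)
  have f_minus: "f A (B - C) = f A B - f A C"
    if "A \<in> carrier_mat n 1" "B \<in> carrier_mat n 1" "C \<in> carrier_mat n 1" for A B C
    using mult_minus_distrib_mat[OF mat_adjoint_carrier[OF that(1)] that(2,3)] that by (simp add: f_def)
  have f_cnj: "f A B = cnj (f B A)"
    if "A \<in> carrier_mat n 1" "B \<in> carrier_mat n 1" for A B
    using that by (auto simp: f_def scalar_prod_def mult.commute intro!: sum.cong)
  have W_adj: "f A (W * B) = f (W * A) B"
    if "A \<in> carrier_mat n 1" "B \<in> carrier_mat n 1" for A B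
    using mat_adjoint_mult[OF w(1) that(1)] assoc_mult_mat[OF mat_adjoint_carrier[OF that(1)] w(1) that(2)] w(2)
    by (simp add: f_def)
  have VV0: "V - V0 \<in> carrier_mat n 1" using V V0 by (auto intro!: carrier_matI)
  have "W * (V - V0) = W * V - U" using mult_minus_distrib_mat[OF w(1) V V0] U(2) by simp
  hence "f (V - V0) (W * (V - V0)) = f (V - V0) (W * V) - f (V - V0) U"
    using f_minus[OF VV0 WV Uc] by simp
  also have "\<dots> = cnj (f (W * V) V - f (W * V) V0) - cnj (f U V - f U V0)"
    using f_cnj[OF VV0 WV] f_cnj[OF VV0 Uc] f_minus[OF WV V V0] f_minus[OF Uc V V0] by simp
  also have "f (W * V) V0 = f V U" using W_adj[OF V V0] U(2) by simp
  also have "f (W * V) V = cnj (f V (W * V))" using f_cnj[OF WV V] .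
  also have "f V (W * V) = f V U - f V (D * V)"
    using f_add[OF V DV WV] dist by simp
  also have "f V U = cnj (f U V)" by (rule f_cnj[OF V Uc])
  \<comment> \<open>In real parts, the gap between U^H V0 and U^H V is thus the form of W at V - V0
    plus the form of D at V, and both are nonnegative.\<close>
  finally have "Re (f (V - V0) (W * (V - V0))) = Re (f U V0) - Re (f U V) - Re (f V (D * V))" by simp
  moreover have "0 \<le> Re (f (V - V0) (W * (V - V0)))" unfolding f_def by (rule hermitian_posdef_form[OF W VV0])
  moreover have "0 \<le> Re (f V (D * V))" unfolding f_def by (rule hermitian_posdef_form[OF D V])
  ultimately show ?thesis by (simp add: f_def)
qed

text \<open>The number q is U^H P^-1 U; it determines both the bordered determinant and the rank-one
  update. The parameter t stays free because one q is used with t = 1 / a and with t =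
  \<kappa>.\<close>

lemma hermitian_posdef_inverse_formE:
  assumes P: "P \<in> hermitian_posdef n" and U: "U \<in> carrier_mat n 1"
  obtains V q where "V \<in> carrier_mat n 1" "P * V = U" "0 \<le> q"
    "(mat_adjoint U * V) $$ (0, 0) = complex_of_real q"
    "\<And>b. det (four_block_mat (complex_of_real b \<cdot>\<^sub>m 1\<^sub>m 1) (mat_adjoint U) U P) = det P * complex_of_real (b - q)"
    "\<And>t. det (P - complex_of_real t \<cdot>\<^sub>m (U * mat_adjoint U)) = det P * complex_of_real (1 - t * q)"
proof -
  note p = hermitian_posdefD[OF P]
  obtain V where V: "V \<in> carrier_mat n 1" "P * V = U"
    using exists_solution[OF p(1) hermitian_posdef_det_nonzero[OF P] U] .
  have U': "mat_adjoint U \<in> carrier_mat 1 n" using U by simp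
  define q where "q = Re ((mat_adjoint U * V) $$ (0, 0))"
  have "mat_adjoint U = mat_adjoint V * P"
    using mat_adjoint_mult[OF p(1) V(1)] p(2) V(2) by simp
  hence "mat_adjoint U * V = mat_adjoint V * (P * V)"
    using assoc_mult_mat[OF mat_adjoint_carrier[OF V(1)] p(1) V(1)] by simp
  hence q: "q \<ge> 0" "(mat_adjoint U * V) $$ (0, 0) = complex_of_real q"
    using hermitian_posdef_form[OF P V(1)] by (auto simp: q_def complex_eq_iff)
  show thesis
  proof (rule that[OF V q])
    show "det (four_block_mat (complex_of_real b \<cdot>\<^sub>m 1\<^sub>m 1) (mat_adjoint U) U P) = det P * complex_of_real (b - q)" for b
      using det_bordered[OF p(1) V(1) _ U', of "complex_of_real b \<cdot>\<^sub>m 1\<^sub>m 1"] unfolding V(2) q(2) by simp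
    show "det (P - complex_of_real t \<cdot>\<^sub>m (U * mat_adjoint U)) = det P * complex_of_real (1 - t * q)" for t
      using det_rank_one_update[OF p(1) V(1) U', of "complex_of_real t"] unfolding V(2) q(2) by simp
  qed
qed

text \<open>Induction on the size: the first coordinate becomes a number g, and the induction
  hypothesis applies to a matrix H on the rest. Up to the factors det W and det (D + W), all
  determinants depend only on scalars, so both claims become scalar ones. That z is chosen before d
  lets it serve both end points of the triangle inequality.\<close>

lemma hermitian_posdef_diagonal_comparison:
  assumes "Z \<in> hermitian_posdef n"
  shows "\<exists>z. (\<forall>i<n. 0 < z i) \<and> det Z = complex_of_real (\<Prod>i<n. z i) \<and>
    (\<forall>d. (\<forall>i<n. 0 < d i) \<longrightarrow> (\<Prod>i<n. d i + z i) \<le> Re (det (real_diag_mat n d + Z)))"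
  using assms
proof (induction n arbitrary: Z)
  case 0
  have "Z \<in> carrier_mat 0 0" using hermitian_posdefD(1)[OF 0] .
  moreover have "real_diag_mat 0 d + Z \<in> carrier_mat 0 0" for d using calculation by auto
  ultimately show ?case by (simp add: det_dim_zero)
next
  case (Suc n)
  obtain a U W where a: "a > 0" and U: "U \<in> carrier_mat n 1" and W: "W \<in> hermitian_posdef n"
    and Z: "Z = four_block_mat (complex_of_real a \<cdot>\<^sub>m 1\<^sub>m 1) (mat_adjoint U) U W"
    using hermitian_posdef_SucE[OF Suc.prems] by metis
  note w = hermitian_posdefD[OF W]
  define R where "R = U * mat_adjoint U"
  have R: "R \<in> carrier_mat n n" using U by (simp add: R_def)
  have S: "W - complex_of_real (1 / a) \<cdot>\<^sub>m R \<in> hermitian_posdef n"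
    unfolding R_def
    using hermitian_posdef_schur_complement(4)[OF Suc.prems[unfolded Z] U w(1)] a by blast
  \<comment> \<open>At size n, positivity of determinants is part of the induction
    hypothesis.\<close>
  have det_pos: "\<exists>r>0. det P = complex_of_real r" if P: "P \<in> hermitian_posdef n" for P
  proof -
    obtain z where "\<forall>i<n. 0 < z i" "det P = complex_of_real (\<Prod>i<n. z i)"
      using Suc.IH[OF P] by blast
    thus ?thesis by (intro exI[of _ "\<Prod>i<n. z i"]) (auto intro!: prod_pos)
  qed
  obtain p0 where p0: "p0 > 0" "det W = complex_of_real p0" using det_pos[OF W] by blast
  obtain V0 q0 where V0: "V0 \<in> carrier_mat n 1" "W * V0 = U"
    and q0: "0 \<le> q0" "(mat_adjoint U * V0) $$ (0, 0) = complex_of_real q0"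
    and detZ: "\<And>b. det (four_block_mat (complex_of_real b \<cdot>\<^sub>m 1\<^sub>m 1) (mat_adjoint U) U W) = det W * complex_of_real (b - q0)"
    and detW: "\<And>t. det (W - complex_of_real t \<cdot>\<^sub>m R) = det W * complex_of_real (1 - t * q0)"
    using hermitian_posdef_inverse_formE[OF W U] unfolding R_def by metis
  \<comment> \<open>The Schur complement of a has the positive determinant det W (1 - q0 / a). This
    makes g below a positive real.\<close>
  have q0a: "q0 < a"
  proof -
    obtain r where r: "r > 0" "det (W - complex_of_real (1 / a) \<cdot>\<^sub>m R) = complex_of_real r"
      using det_pos[OF S] by blast
    have "complex_of_real (p0 * (1 - 1 / a * q0)) = complex_of_real r"
      using r(2) unfolding detW p0(2) by (simp only: of_real_mult)
    hence "p0 * (1 - 1 / a * q0) = r" by (simp only: of_real_eq_iff)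
    hence "1 - 1 / a * q0 > 0" using r(1) p0(1) zero_less_mult_pos by metis
    thus ?thesis using a by (simp add: field_simps)
  qed
  \<comment> \<open>The geometric mean of the pivot a and its Schur complement a - q0.\<close>
  define g where "g = sqrt (a * (a - q0))"
  have g: "g > 0" "g * g = a * (a - q0)" using a q0a by (simp_all add: g_def)
  \<comment> \<open>Chosen so that g (1 - \<kappa> q0) = a - q0, that is, g det H = det Z.\<close>
  define \<kappa> where "\<kappa> = 1 / (a + g)"
  define H where "H = W - complex_of_real \<kappa> \<cdot>\<^sub>m R"
  \<comment> \<open>H is positive definite as a convex combination of W and the Schur complement of
    a.\<close>
  have "complex_of_real (g / (a + g)) \<cdot>\<^sub>m W +
      complex_of_real (a / (a + g)) \<cdot>\<^sub>m (W - complex_of_real (1 / a) \<cdot>\<^sub>m R) \<in> hermitian_posdef n"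
    using a g by (intro hermitian_posdef_add hermitian_posdef_smult W S) auto
  also have "complex_of_real (g / (a + g)) \<cdot>\<^sub>m W +
      complex_of_real (a / (a + g)) \<cdot>\<^sub>m (W - complex_of_real (1 / a) \<cdot>\<^sub>m R) = H"
  proof (rule eq_matI)
    fix i j assume "i < dim_row H" "j < dim_col H"
    hence ij: "i < n" "j < n" using R w(1) by (auto simp: H_def)
    have c: "g / (a + g) = 1 - a / (a + g)" "a / (a + g) * (1 / a) = \<kappa>"
      using a g(1) by (auto simp: \<kappa>_def field_simps)
    have "complex_of_real (1 - \<alpha>) * x + complex_of_real \<alpha> * (x - complex_of_real \<beta> * y) =
      x - complex_of_real (\<alpha> * \<beta>) * y" for \<alpha> \<beta> x y by (simp add: algebra_simps)
    from this[of "a / (a + g)" "W $$ (i, j)" "1 / a" "R $$ (i, j)"]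
    show "(complex_of_real (g / (a + g)) \<cdot>\<^sub>m W +
        complex_of_real (a / (a + g)) \<cdot>\<^sub>m (W - complex_of_real (1 / a) \<cdot>\<^sub>m R)) $$ (i, j) = H $$ (i, j)"
      unfolding H_def using ij R w(1) unfolding c by simp
  qed (use R w(1) in \<open>auto simp: H_def\<close>)
  finally have H: "H \<in> hermitian_posdef n" .
  obtain z where z: "\<forall>i<n. 0 < z i" "det H = complex_of_real (\<Prod>i<n. z i)"
    "\<And>d. \<forall>i<n. 0 < d i \<Longrightarrow> (\<Prod>i<n. d i + z i) \<le> Re (det (real_diag_mat n d + H))"
    using Suc.IH[OF H] by blast
  show ?case
  proof (intro exI[of _ "case_nat g z"] conjI allI impI)
    show "0 < case_nat g z i" if "i < Suc n" for i
      using that z(1) g(1) by (cases i) auto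
    have "complex_of_real (p0 * (1 - \<kappa> * q0)) = complex_of_real (\<Prod>i<n. z i)"
      using z(2) unfolding H_def detW p0(2) by simp
    hence "(\<Prod>i<n. z i) = p0 * (1 - \<kappa> * q0)" by (simp only: of_real_eq_iff)
    moreover have "g * (1 - \<kappa> * q0) = a - q0"
    proof -
      have "g * (a + g - q0) = (a - q0) * (a + g)" using g(2) by (simp add: algebra_simps)
      thus ?thesis using a g(1) by (simp add: \<kappa>_def field_simps)
    qed
    ultimately have "g * (\<Prod>i<n. z i) = p0 * (a - q0)" by simp
    moreover have "(\<Prod>i<Suc n. case_nat g z i) = g * (\<Prod>i<n. z i)"
      by (simp add: prod.lessThan_Suc_shift del: prod.lessThan_Suc)
    ultimately show "det Z = complex_of_real (\<Prod>i<Suc n. case_nat g z i)"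
      unfolding Z detZ p0(2) by (simp only: of_real_mult)
    fix d :: "nat \<Rightarrow> real" assume d: "\<forall>i<Suc n. 0 < d i"
    define D where "D = real_diag_mat n (d \<circ> Suc)"
    have D: "D \<in> hermitian_posdef n" unfolding D_def using d by (intro real_diag_mat_posdef) auto
    have DW: "D + W \<in> hermitian_posdef n" using D W by (rule hermitian_posdef_add)
    note dc = hermitian_posdefD(1)[OF D]
    obtain p where p: "p > 0" "det (D + W) = complex_of_real p" using det_pos[OF DW] by blast
    obtain V q where V: "V \<in> carrier_mat n 1" "(D + W) * V = U"
      and q: "0 \<le> q" "(mat_adjoint U * V) $$ (0, 0) = complex_of_real q"
      and detDZ: "\<And>b. det (four_block_mat (complex_of_real b \<cdot>\<^sub>m 1\<^sub>m 1) (mat_adjoint U) U (D + W)) =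
        det (D + W) * complex_of_real (b - q)"
      and detDW: "\<And>t. det (D + W - complex_of_real t \<cdot>\<^sub>m R) = det (D + W) * complex_of_real (1 - t * q)"
      using hermitian_posdef_inverse_formE[OF DW U] unfolding R_def by metis
    have qq0: "q \<le> q0"
      using hermitian_posdef_inverse_form_antimono[OF W D V(1) V0(1) V(2) V0(2)] unfolding q(2) q0(2) by simp
    have eqDZ: "real_diag_mat (Suc n) d + Z =
        four_block_mat (complex_of_real (d 0 + a) \<cdot>\<^sub>m 1\<^sub>m 1) (mat_adjoint U) U (D + W)"
      unfolding Z real_diag_mat_Suc D_def[symmetric]
      by (subst add_four_block_mat[of _ 1 1 _ n _ n])
         (use U dc w(1) in \<open>auto simp: add_smult_distrib_right_mat[of _ 1 1]\<close>)
    have DZ: "Re (det (real_diag_mat (Suc n) d + Z)) = p * (d 0 + a - q)"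
      unfolding eqDZ detDZ p(2) by (simp only: of_real_mult[symmetric] Re_complex_of_real)
    have eqDH: "D + H = D + W - complex_of_real \<kappa> \<cdot>\<^sub>m R"
      unfolding H_def using dc w(1) R by (intro eq_matI) auto
    have DH: "Re (det (D + H)) = p * (1 - \<kappa> * q)"
      unfolding eqDH detDW p(2) by (simp only: of_real_mult[symmetric] Re_complex_of_real)
    have d0: "d 0 > 0" using d by simp
    have "(\<Prod>i<Suc n. d i + case_nat g z i) = (d 0 + g) * (\<Prod>i<n. (d \<circ> Suc) i + z i)"
      by (simp add: prod.lessThan_Suc_shift del: prod.lessThan_Suc)
    also have "\<dots> \<le> (d 0 + g) * (p * (1 - \<kappa> * q))"
      unfolding DH[symmetric] D_def using d0 g(1) d by (intro mult_left_mono z(3)) auto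
    also have "\<dots> = p * ((d 0 + g) * (1 - \<kappa> * q))" by simp
    also have "\<dots> \<le> p * (d 0 + a - q)"
    proof (intro mult_left_mono)
      \<comment> \<open>After multiplication by a + g and substitution of g g = a (a - q0), the
        right side exceeds the left by a (q0 - q) + q d(0).\<close>
      have "a * q \<le> a * q0" "0 \<le> q * d 0" using a qq0 q(1) d0 by simp_all
      hence "(d 0 + g) * (a + g - q) \<le> (d 0 + a - q) * (a + g)"
        using g(2) by (simp add: algebra_simps)
      thus "(d 0 + g) * (1 - \<kappa> * q) \<le> d 0 + a - q"
        using a g(1) by (simp add: \<kappa>_def field_simps)
    qed (use p(1) in simp)
    finally show "(\<Prod>i<Suc n. d i + case_nat g z i) \<le> Re (det (real_diag_mat (Suc n) d + Z))"
      unfolding DZ .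
  qed
qed

section \<open>Simultaneous diagonalization by congruence\<close>

lemma congruence_mult:
  fixes X :: "complex mat"
  assumes "X \<in> carrier_mat n n" "S \<in> carrier_mat n n" "T \<in> carrier_mat n n"
  shows "mat_adjoint (S * T) * X * (S * T) = mat_adjoint T * (mat_adjoint S * X * S) * T"
proof -
  note S' = mat_adjoint_carrier[OF assms(2)] and T' = mat_adjoint_carrier[OF assms(3)]
  have SX: "mat_adjoint S * X \<in> carrier_mat n n" using S' assms(1) by (rule mult_carrier_mat)
  have "mat_adjoint (S * T) * X * (S * T) = mat_adjoint T * (mat_adjoint S * X) * (S * T)"
    unfolding mat_adjoint_mult[OF assms(2,3)] assoc_mult_mat[OF T' S' assms(1)] ..
  also have "\<dots> = mat_adjoint T * (mat_adjoint S * X) * S * T"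
    using assoc_mult_mat[OF mult_carrier_mat[OF T' SX] assms(2,3)] by (rule sym)
  also have "mat_adjoint T * (mat_adjoint S * X) * S = mat_adjoint T * (mat_adjoint S * X * S)"
    by (rule assoc_mult_mat[OF T' SX assms(2)])
  finally show ?thesis .
qed

text \<open>The vector v is an eigenvector of X^-1 Y, obtained as the solution M of X M = Y; complex
  matrices of positive size have nonempty spectrum.\<close>

lemma pencil_eigenvector:
  assumes X: "X \<in> carrier_mat n n" "det X \<noteq> 0" and Y: "Y \<in> carrier_mat n n" and n: "n > 0"
  shows "\<exists>v \<mu>. v \<in> carrier_vec n \<and> v \<noteq> 0\<^sub>v n \<and> Y *\<^sub>v v = (\<mu> :: complex) \<cdot>\<^sub>v (X *\<^sub>v v)"
proof -
  obtain M where M: "M \<in> carrier_mat n n" "X * M = Y" using exists_solution[OF X Y] .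
  obtain \<mu> where "eigenvalue M \<mu>"
    using spectrum_non_empty[OF M(1) n] unfolding spectrum_def by auto
  then obtain v where v: "v \<in> carrier_vec n" "v \<noteq> 0\<^sub>v n" "M *\<^sub>v v = \<mu> \<cdot>\<^sub>v v"
    unfolding eigenvalue_def eigenvector_def using M(1) by auto
  have "Y *\<^sub>v v = X *\<^sub>v (M *\<^sub>v v)"
    unfolding M(2)[symmetric] by (rule assoc_mult_mat_vec[OF X(1) M(1) v(1)])
  also have "\<dots> = \<mu> \<cdot>\<^sub>v (X *\<^sub>v v)" unfolding v(3) by (rule mult_mat_vec[OF X(1) v(1)])
  finally show ?thesis using v(1,2) by blast
qed

text \<open>Gram-Schmidt, applied to a basis that starts with v, keeps v in first place, and
  orthogonality of the columns supplies a left inverse.\<close>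

lemma exists_mat_first_col:
  fixes v :: "complex vec"
  assumes v: "v \<in> carrier_vec n" "v \<noteq> 0\<^sub>v n" and n: "n > 0"
  shows "\<exists>W \<in> carrier_mat n n. det W \<noteq> 0 \<and> col W 0 = v"
proof -
  interpret cof_vec_space n "TYPE(complex)" .
  define b where "b = basis_completion v"
  define ws where "ws = gram_schmidt n b"
  define W where "W = mat_of_cols n ws"
  note bc = basis_completion[OF v, folded b_def]
  obtain vs where bv: "b = v # vs" using bc(6,7) n by (cases b) auto
  have ws: "set ws \<subseteq> carrier_vec n" "corthogonal ws" "length ws = n"
    using gram_schmidt_result[OF bc(2,4,5) refl, folded ws_def] bc(6) by simp_all
  have hd: "hd ws = v" using gram_schmidt_hd[OF v(1), of vs, folded bv] unfolding ws_def .
  have W: "W \<in> carrier_mat n n" using ws(3) by (auto simp: W_def intro!: carrier_matI)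
  have "inverts_mat (corthogonal_inv W) W"
    using orthogonal_mat_of_cols[OF ws] unfolding W_def by (rule corthogonal_inv_result)
  moreover have W': "corthogonal_inv W \<in> carrier_mat n n"
    using W by (auto simp: corthogonal_inv_def mat_of_rows_def intro!: carrier_matI)
  ultimately have "corthogonal_inv W * W = 1\<^sub>m n" by (simp add: inverts_mat_def)
  hence "det (corthogonal_inv W) * det W = 1" using det_mult[OF W' W] by simp
  hence "det W \<noteq> 0" by auto
  moreover have "ws ! 0 = v" using hd ws(3) n by (cases ws) auto
  hence "col W 0 = v" using ws(3) n v(1) by (simp add: W_def)
  ultimately show ?thesis using W by blast
qed

text \<open>Deflation: a basis starting with a solution v of Y v = \<mu> X v, followed by
  elimination, makes X block diagonal. The first column of the transformed Y is \<mu> times that of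
  the transformed X, so Y becomes block diagonal as well, and the trailing blocks S and R go to the
  induction hypothesis.\<close>

lemma simultaneous_diagonalization:
  assumes "X \<in> hermitian_posdef n" "Y \<in> hermitian_posdef n"
  shows "\<exists>T x y. T \<in> carrier_mat n n \<and> det T \<noteq> 0 \<and> (\<forall>i<n. 0 < x i) \<and> (\<forall>i<n. 0 < y i) \<and>
    mat_adjoint T * X * T = real_diag_mat n x \<and> mat_adjoint T * Y * T = real_diag_mat n y"
  using assms
proof (induction n arbitrary: X Y)
  case 0
  show ?case
    by (intro exI[of _ "1\<^sub>m 0"] exI[of _ "\<lambda>_. 1"])
       (use hermitian_posdefD(1)[OF 0(1)] hermitian_posdefD(1)[OF 0(2)] in \<open>auto intro!: eq_matI\<close>)
next
  case (Suc n)
  note xc = hermitian_posdefD(1)[OF Suc.prems(1)] and yc = hermitian_posdefD(1)[OF Suc.prems(2)]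
  obtain v \<mu> where v: "v \<in> carrier_vec (Suc n)" "v \<noteq> 0\<^sub>v (Suc n)" "Y *\<^sub>v v = \<mu> \<cdot>\<^sub>v (X *\<^sub>v v)"
    using pencil_eigenvector[OF xc hermitian_posdef_det_nonzero[OF Suc.prems(1)] yc] by blast
  obtain W where W: "W \<in> carrier_mat (Suc n) (Suc n)" "det W \<noteq> 0" "col W 0 = v"
    using exists_mat_first_col[OF v(1,2)] by blast
  have X1: "mat_adjoint W * X * W \<in> hermitian_posdef (Suc n)"
    using Suc.prems(1) W(1,2) by (rule hermitian_posdef_congruence)
  obtain a U X3 where a: "a > 0" and U: "U \<in> carrier_mat n 1" and X3: "X3 \<in> hermitian_posdef n"
    and X1eq: "mat_adjoint W * X * W = four_block_mat (complex_of_real a \<cdot>\<^sub>m 1\<^sub>m 1) (mat_adjoint U) U X3"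
    using hermitian_posdef_SucE[OF X1] by metis
  define E where "E = four_block_mat (1\<^sub>m 1) (complex_of_real (- 1 / a) \<cdot>\<^sub>m mat_adjoint U) (0\<^sub>m n 1) (1\<^sub>m n)"
  define S where "S = X3 - complex_of_real (1 / a) \<cdot>\<^sub>m (U * mat_adjoint U)"
  have a0: "a \<noteq> 0" using a by simp
  note sc = hermitian_posdef_schur_complement[OF X1[unfolded X1eq] U hermitian_posdefD(1)[OF X3] a0,
      folded E_def S_def]
  define T1 where "T1 = W * E"
  have T1: "T1 \<in> carrier_mat (Suc n) (Suc n)" "det T1 \<noteq> 0"
    using W sc(1,2) det_mult[OF W(1) sc(1)] by (auto simp: T1_def)
  have X2: "mat_adjoint T1 * X * T1 = four_block_mat (complex_of_real a \<cdot>\<^sub>m 1\<^sub>m 1) (0\<^sub>m 1 n) (0\<^sub>m n 1) S"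
    unfolding T1_def congruence_mult[OF xc W(1) sc(1)] X1eq by (rule sc(3))
  define Y2 where "Y2 = mat_adjoint T1 * Y * T1"
  have Y2: "Y2 \<in> hermitian_posdef (Suc n)"
    unfolding Y2_def using Suc.prems(2) T1 by (rule hermitian_posdef_congruence)
  \<comment> \<open>The elimination matrix fixes the first unit vector, so the first column of
    \<open>W * E\<close> is still v.\<close>
  have "col E 0 = unit_vec (Suc n) 0" unfolding E_def using U by (intro eq_vecI) auto
  moreover have "W *\<^sub>v unit_vec (Suc n) 0 = col W 0"
    using W(1) by (intro eq_vecI) auto
  ultimately have colT1: "col T1 0 = v"
    unfolding T1_def using col_mult2[OF W(1) sc(1), of 0] W(3) by simp
  have col_congr: "col (mat_adjoint T1 * M * T1) 0 = mat_adjoint T1 *\<^sub>v (M *\<^sub>v v)"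
    if M: "M \<in> carrier_mat (Suc n) (Suc n)" for M
  proof -
    have "col (mat_adjoint T1 * M * T1) 0 = (mat_adjoint T1 * M) *\<^sub>v v"
      using col_mult2[OF mult_carrier_mat[OF mat_adjoint_carrier[OF T1(1)] M] T1(1), of 0] unfolding colT1 by simp
    also have "\<dots> = mat_adjoint T1 *\<^sub>v (M *\<^sub>v v)"
      by (rule assoc_mult_mat_vec[OF mat_adjoint_carrier[OF T1(1)] M v(1)])
    finally show ?thesis .
  qed
  have colY2: "col Y2 0 = \<mu> \<cdot>\<^sub>v col (mat_adjoint T1 * X * T1) 0"
    unfolding Y2_def col_congr[OF xc] col_congr[OF yc] v(3)
    by (rule mult_mat_vec[OF mat_adjoint_carrier[OF T1(1)] mult_mat_vec_carrier[OF xc v(1)]])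
  obtain b V R where b: "b > 0" and V: "V \<in> carrier_mat n 1" and R: "R \<in> hermitian_posdef n"
    and Y2eq: "Y2 = four_block_mat (complex_of_real b \<cdot>\<^sub>m 1\<^sub>m 1) (mat_adjoint V) V R"
    and V0: "\<And>i. i < n \<Longrightarrow> V $$ (i, 0) = Y2 $$ (Suc i, 0)"
    using hermitian_posdef_SucE[OF Y2] by metis
  \<comment> \<open>Below the pivot the first column vanishes; the block form then makes the first
    row vanish too.\<close>
  have "V = 0\<^sub>m n 1"
  proof (rule eq_matI)
    fix i j assume "i < dim_row (0\<^sub>m n 1 :: complex mat)" "j < dim_col (0\<^sub>m n 1 :: complex mat)"
    hence ij: "i < n" "j = 0" by auto
    have "Y2 $$ (Suc i, 0) = col Y2 0 $ Suc i"
      using ij hermitian_posdefD(1)[OF Y2] by simp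
    also have "\<dots> = 0"
      unfolding colY2 X2 using ij hermitian_posdefD(1)[OF sc(4)] by simp
    finally show "V $$ (i, j) = 0\<^sub>m n 1 $$ (i, j)" using V0 ij by simp
  qed (use V in auto)
  hence Y2': "Y2 = four_block_mat (complex_of_real b \<cdot>\<^sub>m 1\<^sub>m 1) (0\<^sub>m 1 n) (0\<^sub>m n 1) R"
    using Y2eq by simp
  obtain T' x y where T': "T' \<in> carrier_mat n n" "det T' \<noteq> 0" and pos: "\<forall>i<n. 0 < x i" "\<forall>i<n. 0 < y i"
    and diag: "mat_adjoint T' * S * T' = real_diag_mat n x" "mat_adjoint T' * R * T' = real_diag_mat n y"
    using Suc.IH[OF sc(4) R] by blast
  \<comment> \<open>T' acts on the last n coordinates only, so the pivots a and b become the entries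
    at index 0.\<close>
  define T2 where "T2 = four_block_mat (1\<^sub>m 1) (0\<^sub>m 1 n) (0\<^sub>m n 1) T'"
  have "T2 \<in> carrier_mat (1 + n) (1 + n)" unfolding T2_def by (rule four_block_carrier_mat) (use T' in auto)
  hence T2: "T2 \<in> carrier_mat (Suc n) (Suc n)" by simp
  have dT2: "det T2 = det T'"
    unfolding T2_def using det_four_block_mat_lower_left_zero[OF one_carrier_mat zero_carrier_mat refl T'(1)] by simp
  have T2A: "mat_adjoint T2 = four_block_mat (1\<^sub>m 1) (0\<^sub>m 1 n) (0\<^sub>m n 1) (mat_adjoint T')"
    unfolding T2_def
    using mat_adjoint_four_block[OF one_carrier_mat zero_carrier_mat zero_carrier_mat T'(1)] by simp
  have block: "mat_adjoint T2 * four_block_mat (complex_of_real c \<cdot>\<^sub>m 1\<^sub>m 1) (0\<^sub>m 1 n) (0\<^sub>m n 1) M * T2 =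
      real_diag_mat (Suc n) (case_nat c d)"
    if M: "M \<in> carrier_mat n n" "mat_adjoint T' * M * T' = real_diag_mat n d" for c M d
  proof -
    have TM: "mat_adjoint T' * M \<in> carrier_mat n n" using T' M by auto
    have 1: "mat_adjoint T2 * four_block_mat (complex_of_real c \<cdot>\<^sub>m 1\<^sub>m 1) (0\<^sub>m 1 n) (0\<^sub>m n 1) M =
        four_block_mat (complex_of_real c \<cdot>\<^sub>m 1\<^sub>m 1) (0\<^sub>m 1 n) (0\<^sub>m n 1) (mat_adjoint T' * M)"
      unfolding T2A
      by (subst mult_four_block_mat[OF one_carrier_mat zero_carrier_mat zero_carrier_mat mat_adjoint_carrier[OF T'(1)]
            smult_carrier_mat[OF one_carrier_mat] zero_carrier_mat zero_carrier_mat M(1)])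
         (use TM M T' in simp)
    have "four_block_mat (complex_of_real c \<cdot>\<^sub>m 1\<^sub>m 1) (0\<^sub>m 1 n) (0\<^sub>m n 1) (mat_adjoint T' * M) * T2 =
        four_block_mat (complex_of_real c \<cdot>\<^sub>m 1\<^sub>m 1) (0\<^sub>m 1 n) (0\<^sub>m n 1) (mat_adjoint T' * M * T')"
      unfolding T2_def
      by (subst mult_four_block_mat[OF smult_carrier_mat[OF one_carrier_mat] zero_carrier_mat zero_carrier_mat TM
            one_carrier_mat zero_carrier_mat zero_carrier_mat T'(1)])
         (use TM mult_carrier_mat[OF TM T'(1)] T' in \<open>simp add: right_mult_zero_mat[OF TM]\<close>)
    moreover have "case_nat c d \<circ> Suc = d" by (simp add: fun_eq_iff)
    ultimately show ?thesis unfolding 1 M(2) real_diag_mat_Suc by simp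
  qed
  show ?case
  proof (intro exI conjI allI impI)
    show "T1 * T2 \<in> carrier_mat (Suc n) (Suc n)" using T1(1) T2 by (rule mult_carrier_mat)
    show "det (T1 * T2) \<noteq> 0" unfolding det_mult[OF T1(1) T2] dT2 using T1(2) T'(2) by simp
    show "0 < case_nat a x i" "0 < case_nat b y i" if "i < Suc n" for i
      using that pos a b by (auto split: nat.split)
    show "mat_adjoint (T1 * T2) * X * (T1 * T2) = real_diag_mat (Suc n) (case_nat a x)"
      unfolding congruence_mult[OF xc T1(1) T2] X2 by (rule block[OF hermitian_posdefD(1)[OF sc(4)] diag(1)])
    show "mat_adjoint (T1 * T2) * Y * (T1 * T2) = real_diag_mat (Suc n) (case_nat b y)"
      unfolding congruence_mult[OF yc T1(1) T2] Y2_def[symmetric] Y2'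
      by (rule block[OF hermitian_posdefD(1)[OF R] diag(2)])
  qed
qed

section \<open>The metric\<close>

text \<open>Read off from the comparison lemma, which exhibits the determinant as a product of
  positive reals.\<close>

lemma hermitian_posdef_det_pos:
  assumes "X \<in> hermitian_posdef n"
  shows "det X = complex_of_real (Re (det X))" "0 < Re (det X)"
proof -
  obtain z where "\<forall>i<n. 0 < z i" "det X = complex_of_real (\<Prod>i<n. z i)"
    using hermitian_posdef_diagonal_comparison[OF assms] by blast
  thus "det X = complex_of_real (Re (det X))" "0 < Re (det X)"
    by (auto intro!: prod_pos simp del: of_real_prod)
qed

text \<open>Multiplicativity splits the logarithms, and the factor 1/2 contributes n ln 2. Symmetry
  and congruence invariance can then be checked on log-determinants.\<close>

lemma S_divergence_altdef:
  assumes X: "X \<in> hermitian_posdef n" and Y: "Y \<in> hermitian_posdef n"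
  shows "S_divergence X Y =
    ln (Re (det (X + Y))) - real n * ln 2 - (ln (Re (det X)) + ln (Re (det Y))) / 2"
proof -
  note xc = hermitian_posdefD(1)[OF X] and yc = hermitian_posdefD(1)[OF Y]
  note XY = hermitian_posdef_det_pos[OF hermitian_posdef_add[OF X Y]]
  have "det ((1/2) \<cdot>\<^sub>m (X + Y)) = (1/2) ^ n * det (X + Y)" using xc yc by simp
  also have "\<dots> = complex_of_real ((1/2) ^ n * Re (det (X + Y)))" by (subst XY(1)) simp
  finally have 1: "Re (det ((1/2) \<cdot>\<^sub>m (X + Y))) = (1/2) ^ n * Re (det (X + Y))" by simp
  have "det (X * Y) = complex_of_real (Re (det X) * Re (det Y))"
    unfolding det_mult[OF xc yc] of_real_mult
      hermitian_posdef_det_pos(1)[OF X, symmetric] hermitian_posdef_det_pos(1)[OF Y, symmetric] ..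
  hence 2: "Re (det (X * Y)) = Re (det X) * Re (det Y)" by simp
  have "ln ((1/2) ^ n * Re (det (X + Y))) = ln (Re (det (X + Y))) - real n * ln 2"
    using XY(2) by (simp add: ln_mult ln_realpow ln_div)
  thus ?thesis
    unfolding S_divergence_def 1 2
    using hermitian_posdef_det_pos(2)[OF X] hermitian_posdef_det_pos(2)[OF Y] by (simp add: ln_mult)
qed

lemma S_divergence_commute:
  assumes X: "X \<in> hermitian_posdef n" and Y: "Y \<in> hermitian_posdef n"
  shows "S_divergence X Y = S_divergence Y X"
  unfolding S_divergence_altdef[OF X Y] S_divergence_altdef[OF Y X]
    comm_add_mat[OF hermitian_posdefD(1)[OF X] hermitian_posdefD(1)[OF Y]] by simp

lemma det_congruence:
  fixes X :: "complex mat"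
  assumes X: "X \<in> carrier_mat n n" and T: "T \<in> carrier_mat n n"
  shows "Re (det (mat_adjoint T * X * T)) = (cmod (det T))\<^sup>2 * Re (det X)"
proof -
  note T' = mat_adjoint_carrier[OF T]
  have "det (mat_adjoint T * X * T) = complex_of_real ((cmod (det T))\<^sup>2) * det X"
    unfolding det_mult[OF mult_carrier_mat[OF T' X] T] det_mult[OF T' X] det_mat_adjoint[OF T]
    by (simp only: complex_norm_square mult_ac)
  thus ?thesis by simp
qed

text \<open>Each log-determinant gains 2 ln |det T|; X + Y enters with weight 1, X and Y with weight
  -1/2 each, so the gains cancel.\<close>

lemma S_divergence_congruence:
  assumes X: "X \<in> hermitian_posdef n" and Y: "Y \<in> hermitian_posdef n"
    and T: "T \<in> carrier_mat n n" "det T \<noteq> 0"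
  shows "S_divergence (mat_adjoint T * X * T) (mat_adjoint T * Y * T) = S_divergence X Y"
proof -
  note xc = hermitian_posdefD(1)[OF X] and yc = hermitian_posdefD(1)[OF Y] and T' = mat_adjoint_carrier[OF T(1)]
  have "mat_adjoint T * X * T + mat_adjoint T * Y * T = mat_adjoint T * (X + Y) * T"
    unfolding mult_add_distrib_mat[OF T' xc yc]
    using add_mult_distrib_mat[OF mult_carrier_mat[OF T' xc] mult_carrier_mat[OF T' yc] T(1)] by (rule sym)
  moreover have "ln (Re (det (mat_adjoint T * M * T))) = 2 * ln (cmod (det T)) + ln (Re (det M))"
    if M: "M \<in> hermitian_posdef n" for M
    unfolding det_congruence[OF hermitian_posdefD(1)[OF M] T(1)]
    using hermitian_posdef_det_pos(2)[OF M] T(2) by (simp add: ln_mult ln_realpow)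
  ultimately show ?thesis
    unfolding S_divergence_altdef[OF hermitian_posdef_congruence[OF X T] hermitian_posdef_congruence[OF Y T]]
      S_divergence_altdef[OF X Y]
    using X Y hermitian_posdef_add[OF X Y] by (simp add: field_simps)
qed

text \<open>The right side has the shape of \<open>S_divergence_altdef\<close> with products for
  determinants, ready for comparison with the matrix divergence.\<close>

lemma sum_scalar_S:
  assumes "\<And>i. i < n \<Longrightarrow> 0 < x i" "\<And>i. i < n \<Longrightarrow> 0 < y i"
  shows "(\<Sum>i<n. scalar_S (x i) (y i)) =
    ln (\<Prod>i<n. x i + y i) - real n * ln 2 - (ln (\<Prod>i<n. x i) + ln (\<Prod>i<n. y i)) / 2"
proof -
  have "ln (\<Prod>i<n. f i) = (\<Sum>i<n. ln (f i))" if "\<And>i. i < n \<Longrightarrow> 0 < f i" for f :: "nat \<Rightarrow> real"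
    using that by (intro ln_prod) (auto simp: less_imp_neq[symmetric])
  moreover have "scalar_S (x i) (y i) = ln (x i + y i) - ln 2 - (ln (x i) + ln (y i)) / 2" if "i < n" for i
    using assms[OF that] by (simp add: scalar_S_def ln_div)
  ultimately show ?thesis
    using assms by (simp add: sum_subtractf sum.distrib add_pos_pos flip: sum_divide_distrib)
qed

lemma S_divergence_diag:
  assumes "\<And>i. i < n \<Longrightarrow> 0 < x i" "\<And>i. i < n \<Longrightarrow> 0 < y i"
  shows "S_divergence (real_diag_mat n x) (real_diag_mat n y) = (\<Sum>i<n. scalar_S (x i) (y i))"
proof -
  have "real_diag_mat n x \<in> hermitian_posdef n" "real_diag_mat n y \<in> hermitian_posdef n"
    using assms by (intro real_diag_mat_posdef; simp)+
  from S_divergence_altdef[OF this] show ?thesis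
    using sum_scalar_S[of n x y] assms by (simp add: real_diag_mat_add det_real_diag_mat del: of_real_prod)
qed

text \<open>The diagonal matrix with entries z has the determinant of Z, so only the log-determinant
  of the sum changes, and it cannot grow.\<close>

lemma S_divergence_diag_comparison:
  assumes Z: "Z \<in> hermitian_posdef n"
  shows "\<exists>z. (\<forall>i<n. 0 < z i) \<and>
    (\<forall>x. (\<forall>i<n. 0 < x i) \<longrightarrow> (\<Sum>i<n. scalar_S (x i) (z i)) \<le> S_divergence (real_diag_mat n x) Z)"
proof -
  obtain z where z: "\<forall>i<n. 0 < z i" "det Z = complex_of_real (\<Prod>i<n. z i)"
    "\<And>x. \<forall>i<n. 0 < x i \<Longrightarrow> (\<Prod>i<n. x i + z i) \<le> Re (det (real_diag_mat n x + Z))"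
    using hermitian_posdef_diagonal_comparison[OF Z] by blast
  have "(\<Sum>i<n. scalar_S (x i) (z i)) \<le> S_divergence (real_diag_mat n x) Z" if x: "\<forall>i<n. 0 < x i" for x
  proof -
    have X: "real_diag_mat n x \<in> hermitian_posdef n" using x by (intro real_diag_mat_posdef) auto
    have "0 < (\<Prod>i<n. x i + z i)" using x z(1) by (auto intro!: prod_pos add_pos_pos)
    hence "ln (\<Prod>i<n. x i + z i) \<le> ln (Re (det (real_diag_mat n x + Z)))"
      using z(3)[OF x] by (intro ln_mono) auto
    thus ?thesis
      using sum_scalar_S[of n x z] x z(1) unfolding S_divergence_altdef[OF X Z] z(2) det_real_diag_mat
      by (simp del: of_real_prod)
  qed
  thus ?thesis using z(1) by blast
qed

lemma congruence_inject:
  fixes X Y :: "complex mat"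
  assumes X: "X \<in> carrier_mat n n" and Y: "Y \<in> carrier_mat n n" and T: "T \<in> carrier_mat n n" "det T \<noteq> 0"
    and eq: "mat_adjoint T * X * T = mat_adjoint T * Y * T"
  shows "X = Y"
proof -
  obtain B where B: "B \<in> carrier_mat n n" "T * B = 1\<^sub>m n" using exists_solution[OF T one_carrier_mat] .
  have "M = mat_adjoint B * (mat_adjoint T * M * T) * B" if "M \<in> carrier_mat n n" for M
    using congruence_mult[OF that T(1) B(1)] that unfolding B(2) by simp
  from this[OF X] this[OF Y] eq show ?thesis by simp
qed

text \<open>After simultaneous diagonalization the divergence is a sum of nonnegative scalar
  divergences, zero only if every term is; injectivity of the congruence carries equality
  back.\<close>

lemma S_divergence_nonneg_zero_iff:
  assumes X: "X \<in> hermitian_posdef n" and Y: "Y \<in> hermitian_posdef n"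
  shows "0 \<le> S_divergence X Y" "S_divergence X Y = 0 \<longleftrightarrow> X = Y"
proof -
  obtain T x y where T: "T \<in> carrier_mat n n" "det T \<noteq> 0" and pos: "\<forall>i<n. 0 < x i" "\<forall>i<n. 0 < y i"
    and diag: "mat_adjoint T * X * T = real_diag_mat n x" "mat_adjoint T * Y * T = real_diag_mat n y"
    using simultaneous_diagonalization[OF X Y] by blast
  have S: "S_divergence X Y = (\<Sum>i<n. scalar_S (x i) (y i))"
    using S_divergence_congruence[OF X Y T] S_divergence_diag[of n x y] pos unfolding diag by simp
  have nn: "\<And>i. i \<in> {..<n} \<Longrightarrow> 0 \<le> scalar_S (x i) (y i)" using pos by (simp add: scalar_S_nonneg)
  show "0 \<le> S_divergence X Y" unfolding S by (rule sum_nonneg[OF nn])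
  have "S_divergence X Y = 0 \<longleftrightarrow> (\<forall>i<n. x i = y i)"
  proof -
    have "(\<Sum>i<n. scalar_S (x i) (y i)) = 0 \<longleftrightarrow> (\<forall>i\<in>{..<n}. scalar_S (x i) (y i) = 0)"
      by (rule sum_nonneg_eq_0_iff[OF finite_lessThan nn])
    thus ?thesis unfolding S using pos by (auto simp: scalar_S_eq_0_iff)
  qed
  moreover have "X = Y" if "\<forall>i<n. x i = y i"
    using congruence_inject[OF hermitian_posdefD(1)[OF X] hermitian_posdefD(1)[OF Y] T]
      real_diag_mat_cong[of n x y] that unfolding diag by simp
  moreover have "\<forall>i<n. x i = y i" if "X = Y"
  proof (intro allI impI)
    fix i assume "i < n"
    thus "x i = y i"
      using arg_cong[OF diag(1)[unfolded that diag(2)], of "\<lambda>M. M $$ (i, i)"] by (simp add: real_diag_mat_def)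
  qed
  ultimately show "S_divergence X Y = 0 \<longleftrightarrow> X = Y" by blast
qed

text \<open>Once the end points are diagonal, the transformed middle matrix Y' is replaced by a
  diagonal one that is no farther from either of them.\<close>

lemma sqrt_S_divergence_triangle:
  assumes X: "X \<in> hermitian_posdef n" and Y: "Y \<in> hermitian_posdef n" and Z: "Z \<in> hermitian_posdef n"
  shows "sqrt (S_divergence X Z) \<le> sqrt (S_divergence X Y) + sqrt (S_divergence Y Z)"
proof -
  obtain T x z where T: "T \<in> carrier_mat n n" "det T \<noteq> 0" and pos: "\<forall>i<n. 0 < x i" "\<forall>i<n. 0 < z i"
    and diag: "mat_adjoint T * X * T = real_diag_mat n x" "mat_adjoint T * Z * T = real_diag_mat n z"
    using simultaneous_diagonalization[OF X Z] by blast
  define Y' where "Y' = mat_adjoint T * Y * T"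
  have Y': "Y' \<in> hermitian_posdef n" unfolding Y'_def by (rule hermitian_posdef_congruence[OF Y T])
  have D: "real_diag_mat n z \<in> hermitian_posdef n" using pos by (intro real_diag_mat_posdef) auto
  obtain y where y: "\<forall>i<n. 0 < y i"
    "\<And>d. \<forall>i<n. 0 < d i \<Longrightarrow> (\<Sum>i<n. scalar_S (d i) (y i)) \<le> S_divergence (real_diag_mat n d) Y'"
    using S_divergence_diag_comparison[OF Y'] by blast
  have "S_divergence X Z = (\<Sum>i<n. scalar_S (x i) (z i))"
    using S_divergence_congruence[OF X Z T] S_divergence_diag[of n x z] pos unfolding diag by simp
  hence "sqrt (S_divergence X Z) \<le> sqrt (\<Sum>i<n. scalar_S (x i) (y i)) + sqrt (\<Sum>i<n. scalar_S (y i) (z i))"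
    using sqrt_sum_scalar_S_triangle[of "{..<n}" x z y] pos y(1) by simp
  \<comment> \<open>The comparison has the diagonal end point as first argument, so the scalar
    divergence is flipped.\<close>
  also have "(\<Sum>i<n. scalar_S (y i) (z i)) = (\<Sum>i<n. scalar_S (z i) (y i))"
    by (simp add: scalar_S_def add.commute)
  also have "sqrt (\<Sum>i<n. scalar_S (x i) (y i)) + sqrt (\<Sum>i<n. scalar_S (z i) (y i)) \<le>
      sqrt (S_divergence (real_diag_mat n x) Y') + sqrt (S_divergence (real_diag_mat n z) Y')"
    using y(2)[OF pos(1)] y(2)[OF pos(2)] by (intro add_mono real_sqrt_le_mono)
  also have "S_divergence (real_diag_mat n x) Y' = S_divergence X Y"
    using S_divergence_congruence[OF X Y T] unfolding diag Y'_def .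
  also have "S_divergence (real_diag_mat n z) Y' = S_divergence Y Z"
    using S_divergence_congruence[OF Z Y T] S_divergence_commute[OF Y Z] unfolding diag Y'_def by simp
  finally show ?thesis .
qed

theorem theorem3p1:
  fixes n :: nat
  shows "Metric_space (hermitian_posdef n) (delta_S n)"
proof
  fix X Y Z
  \<comment> \<open>Nonnegativity and symmetry are claimed for all matrices; outside the carrier
    \<open>delta_S\<close> is 0.\<close>
  show "0 \<le> delta_S n X Y"
    using S_divergence_nonneg_zero_iff(1)[of X n Y] by (simp add: delta_S_def)
  show "delta_S n X Y = delta_S n Y X"
    by (auto simp: delta_S_def S_divergence_commute)
  show "delta_S n X Y = 0 \<longleftrightarrow> X = Y" if "X \<in> hermitian_posdef n" "Y \<in> hermitian_posdef n"
    using that by (simp add: delta_S_def S_divergence_nonneg_zero_iff(2))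
  show "delta_S n X Z \<le> delta_S n X Y + delta_S n Y Z"
    if "X \<in> hermitian_posdef n" "Y \<in> hermitian_posdef n" "Z \<in> hermitian_posdef n"
    using that by (simp add: delta_S_def sqrt_S_divergence_triangle)
qed

end
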